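(* Let $T:M\to M$ be a continuous transformation of a complete Riemannian manifold, preserving an ergodic $T$-invariant Borel probability measure $\mu$. Then $$h_{\mu}(T)\leq h^{\mathcal{L}}_{\mu}(T).$$
   Context: $h_\mu(T)$ is the measure-theoretic (Kolmogorov–Sinai) entropy of $T$ with respect to $\mu$ (supremum of $h_\mu(T,\mathcal{P})$ over finite measurable partitions $\mathcal{P}$). Let $d$ be the Riemannian distance and $\mathcal{L}$ the Riemannian volume on $M$. For $n\geq1$ let $d_n(x,y)=\max_{0\leq i\leq n-1}d(T^ix,T^iy)$, and let $B_n(x,r)$ be the open $d_n$-ball of center $x$ and radius $r$ (the $(n,r)$-dynamical ball). For a compact set $K\subset M$ with $\mu(K)>0$, the local Riemannian entropy of $T$ relative to $\mu$ over $K$ is $$h^{\mathcal{L}}_{\mu}(T,K)=\operatorname*{ess\,sup}_{x\in K}\ \lim_{r\to 0}\ \limsup_{n\to\infty,\ T^{n}x\in K} -\frac{1}{n}\log \mathcal{L}(B_{n}(x,r)),$$ where the essential supremum is with respect to $\mu$ and the limsup is along the integers $n$ with $T^nx\in K$. The local Riemannian entropy of $T$ relative to $\mu$ is $h^{\mathcal{L}}_{\mu}(T)=\sup_{K}h^{\mathcal{L}}_{\mu}(T,K)$, the supremum being over all compact $K\subset M$ with $\mu(K)>0$. *)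

theory Defs
  imports "HOL-Probability.Probability"
begin

section \<open>Riemannian manifolds\<close>

text \<open>
  For an open set \<open>S\<close>, \<open>Ck_on k f S\<close> says that \<open>f\<close> is of class \<open>C\<^sup>k\<close> on \<open>S\<close>: all iterated
  directional derivatives up to order \<open>k\<close> exist (as Frechet derivatives) and are continuous.
\<close>

primrec Ck_on :: "nat \<Rightarrow> ('a::real_normed_vector \<Rightarrow> 'b::real_normed_vector) \<Rightarrow> 'a set \<Rightarrow> bool" where
  "Ck_on 0 f S \<longleftrightarrow> continuous_on S f"
| "Ck_on (Suc k) f S \<longleftrightarrow>
     (\<forall>x\<in>S. f differentiable (at x)) \<and> (\<forall>v. Ck_on k (\<lambda>x. frechet_derivative f (at x) v) S)"

definition smooth_on :: "'a set \<Rightarrow> ('a::real_normed_vector \<Rightarrow> 'b::real_normed_vector) \<Rightarrow> bool" where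
  "smooth_on S f \<longleftrightarrow> (\<forall>k. Ck_on k f S)"

text \<open>
  A chart is a pair of its domain and its coordinate map; the values of the coordinate map
  outside of the domain are irrelevant.
\<close>

type_synonym ('m, 'n) chart = "'m set \<times> ('m \<Rightarrow> real ^ 'n)"

definition transition :: "('m, 'n::finite) chart \<Rightarrow> ('m, 'n) chart \<Rightarrow> real ^ 'n \<Rightarrow> real ^ 'n" where
  "transition c c' = snd c' \<circ> inv_into (fst c) (snd c)"

definition smooth_atlas :: "('m::topological_space, 'n::finite) chart set \<Rightarrow> bool" where
  "smooth_atlas \<A> \<longleftrightarrow>
     (\<Union>c\<in>\<A>. fst c) = UNIV \<and>
     (\<forall>(U, \<phi>)\<in>\<A>. open U \<and> open (\<phi> ` U) \<and> (\<exists>\<psi>. homeomorphism U (\<phi> ` U) \<phi> \<psi>)) \<and>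
     (\<forall>c\<in>\<A>. \<forall>c'\<in>\<A>. smooth_on (snd c ` (fst c \<inter> fst c')) (transition c c'))"

text \<open>
  A Riemannian metric is given by its matrix \<open>g c y\<close> at the point with coordinates \<open>y\<close> in
  the chart \<open>c\<close>, subject to the transformation law of covariant 2-tensors.
\<close>

definition riemannian_metric ::
  "('m::topological_space, 'n::finite) chart set \<Rightarrow> (('m, 'n) chart \<Rightarrow> real ^ 'n \<Rightarrow> real ^ 'n ^ 'n) \<Rightarrow> bool" where
  "riemannian_metric \<A> g \<longleftrightarrow>
     (\<forall>c\<in>\<A>. smooth_on (snd c ` fst c) (g c) \<and>
        (\<forall>y\<in>snd c ` fst c. transpose (g c y) = g c y \<and> (\<forall>v. v \<noteq> 0 \<longrightarrow> v \<bullet> (g c y *v v) > 0))) \<and>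
     (\<forall>c\<in>\<A>. \<forall>c'\<in>\<A>. \<forall>x\<in>fst c \<inter> fst c'.
        let J = matrix (frechet_derivative (transition c c') (at (snd c x)))
        in g c (snd c x) = transpose J ** g c' (snd c' x) ** J)"

text \<open>
  As for \<^const>\<open>piecewise_C1_differentiable_on\<close>, the velocity of a piecewise \<open>C\<^sup>1\<close> curve is not
  required to have one-sided limits at the break points. Since the curve is continuous there and
  its length is a Lebesgue integral with values in \<open>[0, \<infinity>]\<close>, this does not change the infimum
  of the lengths of the curves between two points.
\<close>

definition piecewise_C1_curve ::
  "('m::topological_space, 'n::finite) chart set \<Rightarrow> (real \<Rightarrow> 'm) \<Rightarrow> bool" where
  "piecewise_C1_curve \<A> \<gamma> \<longleftrightarrow>
     path \<gamma> \<and>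
     (\<exists>S. finite S \<and> (\<forall>(U, \<phi>)\<in>\<A>. (\<phi> \<circ> \<gamma>) C1_differentiable_on ({0<..<1} \<inter> \<gamma> -` U - S)))"

text \<open>By the transformation law, the speed does not depend on the chart that is picked.\<close>

definition speed ::
  "('m, 'n::finite) chart set \<Rightarrow> (('m, 'n) chart \<Rightarrow> real ^ 'n \<Rightarrow> real ^ 'n ^ 'n) \<Rightarrow> (real \<Rightarrow> 'm) \<Rightarrow> real \<Rightarrow> real" where
  "speed \<A> g \<gamma> t =
     (let c = (SOME c. c \<in> \<A> \<and> \<gamma> t \<in> fst c);
          v = vector_derivative (snd c \<circ> \<gamma>) (at t)
      in sqrt (v \<bullet> (g c (snd c (\<gamma> t)) *v v)))"

definition curve_length ::
  "('m, 'n::finite) chart set \<Rightarrow> (('m, 'n) chart \<Rightarrow> real ^ 'n \<Rightarrow> real ^ 'n ^ 'n) \<Rightarrow> (real \<Rightarrow> 'm) \<Rightarrow> ennreal" where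
  "curve_length \<A> g \<gamma> = (\<integral>\<^sup>+t\<in>{0<..<1}. ennreal (speed \<A> g \<gamma> t) \<partial>lborel)"

definition riemannian_distance ::
  "('m::topological_space, 'n::finite) chart set \<Rightarrow> (('m, 'n) chart \<Rightarrow> real ^ 'n \<Rightarrow> real ^ 'n ^ 'n) \<Rightarrow>
     'm \<Rightarrow> 'm \<Rightarrow> ennreal" where
  "riemannian_distance \<A> g x y =
     (INF \<gamma>\<in>{\<gamma>. piecewise_C1_curve \<A> \<gamma> \<and> pathstart \<gamma> = x \<and> pathfinish \<gamma> = y}. curve_length \<A> g \<gamma>)"

text \<open>
  The distance of the type \<open>'m\<close> is the Riemannian distance. As it is finite, and the
  infimum of the empty set is \<open>\<infinity>\<close>, the manifold is connected. The manifold is complete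
  when \<open>'m\<close> is moreover of class \<^class>\<open>complete_space\<close>.
\<close>

definition riemannian_manifold ::
  "('m::{metric_space, second_countable_topology}, 'n::finite) chart set \<Rightarrow>
     (('m, 'n) chart \<Rightarrow> real ^ 'n \<Rightarrow> real ^ 'n ^ 'n) \<Rightarrow> bool" where
  "riemannian_manifold \<A> g \<longleftrightarrow>
     smooth_atlas \<A> \<and> riemannian_metric \<A> g \<and>
     (\<forall>x y. riemannian_distance \<A> g x y = ennreal (dist x y))"

text \<open>
  The Riemannian volume is the unique Borel measure with density \<open>sqrt (det g)\<close> in each
  chart; uniqueness holds because countably many charts cover the manifold.
\<close>

definition is_riemannian_volume ::
  "('m::topological_space, 'n::finite) chart set \<Rightarrow> (('m, 'n) chart \<Rightarrow> real ^ 'n \<Rightarrow> real ^ 'n ^ 'n) \<Rightarrow>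
     'm measure \<Rightarrow> bool" where
  "is_riemannian_volume \<A> g \<L> \<longleftrightarrow>
     sets \<L> = sets borel \<and>
     (\<forall>(U, \<phi>)\<in>\<A>. \<forall>B\<in>sets borel. B \<subseteq> U \<longrightarrow>
        emeasure \<L> B = (\<integral>\<^sup>+y\<in>\<phi> ` B. ennreal (sqrt (det (g (U, \<phi>) y))) \<partial>lborel))"


section \<open>Measure-theoretic entropy\<close>

definition invariant_measure :: "('a \<Rightarrow> 'a) \<Rightarrow> 'a measure \<Rightarrow> bool" where
  "invariant_measure T M \<longleftrightarrow> T \<in> measurable M M \<and> distr M M T = M"

definition ergodic :: "('a \<Rightarrow> 'a) \<Rightarrow> 'a measure \<Rightarrow> bool" where
  "ergodic T M \<longleftrightarrow>
     (\<forall>B\<in>sets M. T -` B \<inter> space M = B \<longrightarrow> measure M B = 0 \<or> measure M B = 1)"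

definition finite_measurable_partition :: "'a measure \<Rightarrow> 'a set set \<Rightarrow> bool" where
  "finite_measurable_partition M P \<longleftrightarrow> finite P \<and> P \<subseteq> sets M \<and> partition_on (space M) P"

definition partition_entropy :: "'a measure \<Rightarrow> 'a set set \<Rightarrow> real" where
  "partition_entropy M P = - (\<Sum>B\<in>P. measure M B * ln (measure M B))"

text \<open>The join of the partitions \<open>T\<^sup>-\<^sup>i P\<close> for \<open>i < n\<close>, without empty cells.\<close>

primrec iterated_join :: "'a measure \<Rightarrow> ('a \<Rightarrow> 'a) \<Rightarrow> 'a set set \<Rightarrow> nat \<Rightarrow> 'a set set" where
  "iterated_join M T P 0 = {space M}"
| "iterated_join M T P (Suc n) =
     {A \<inter> (T ^^ n) -` B | A B. A \<in> iterated_join M T P n \<and> B \<in> P} - {{}}"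

definition entropy_wrt_partition :: "'a measure \<Rightarrow> ('a \<Rightarrow> 'a) \<Rightarrow> 'a set set \<Rightarrow> ereal" where
  "entropy_wrt_partition M T P =
     lim (\<lambda>n. ereal (partition_entropy M (iterated_join M T P n) / real n))"

definition ks_entropy :: "'a measure \<Rightarrow> ('a \<Rightarrow> 'a) \<Rightarrow> ereal" where
  "ks_entropy M T = (SUP P\<in>{P. finite_measurable_partition M P}. entropy_wrt_partition M T P)"


section \<open>Local Riemannian entropy\<close>

text \<open>The next two definitions are meaningful for \<open>n \<ge> 1\<close> only.\<close>

definition dyn_dist :: "('m::metric_space \<Rightarrow> 'm) \<Rightarrow> nat \<Rightarrow> 'm \<Rightarrow> 'm \<Rightarrow> real" where
  "dyn_dist T n x y = (MAX i\<in>{..<n}. dist ((T ^^ i) x) ((T ^^ i) y))"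

definition dyn_ball :: "('m::metric_space \<Rightarrow> 'm) \<Rightarrow> nat \<Rightarrow> 'm \<Rightarrow> real \<Rightarrow> 'm set" where
  "dyn_ball T n x r = {y. dyn_dist T n x y < r}"

text \<open>
  In a complete manifold the dynamical balls have positive finite volume, so no conventions for
  the logarithm of \<open>0\<close> and \<open>\<infinity>\<close> are needed. The upper limit is along the integers \<open>n\<close> with
  \<open>T\<^sup>n x \<in> K\<close>; it is \<open>-\<infinity>\<close> if there are finitely many of them, which by Poincare recurrence
  happens only for a null set of points \<open>x\<close> of \<open>K\<close>.
\<close>

definition local_volume_growth ::
  "'m measure \<Rightarrow> ('m::metric_space \<Rightarrow> 'm) \<Rightarrow> 'm set \<Rightarrow> 'm \<Rightarrow> ereal" where
  "local_volume_growth \<L> T K x =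
     Lim (at_right 0) (\<lambda>r. Limsup (inf sequentially (principal {n. (T ^^ n) x \<in> K}))
       (\<lambda>n. ereal (- (1 / real n) * ln (measure \<L> (dyn_ball T n x r)))))"

definition local_riemannian_entropy_on ::
  "'m measure \<Rightarrow> 'm measure \<Rightarrow> ('m::metric_space \<Rightarrow> 'm) \<Rightarrow> 'm set \<Rightarrow> ereal" where
  "local_riemannian_entropy_on \<L> \<mu> T K = esssup (restrict_space \<mu> K) (local_volume_growth \<L> T K)"

definition local_riemannian_entropy ::
  "'m measure \<Rightarrow> 'm measure \<Rightarrow> ('m::metric_space \<Rightarrow> 'm) \<Rightarrow> ereal" where
  "local_riemannian_entropy \<L> \<mu> T =
     (SUP K\<in>{K. compact K \<and> emeasure \<mu> K > 0}. local_riemannian_entropy_on \<L> \<mu> T K)"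

end

theory Submission
  imports Defs
begin

text \<open>
  Let \<open>h\<close> exceed the local Riemannian entropy and let \<open>P\<close> be a finite measurable partition with
  \<open>k\<close> cells; the claim is \<open>h\<^sub>\<mu>(T, P) \<le> h\<close>. The proof counts: outside a set of small measure the
  space is covered by roughly \<open>e\<^sup>n\<^sup>h\<close> cells of the join \<open>P\<^sub>n\<close> of the partitions \<open>T\<^sup>-\<^sup>i P\<close> with
  \<open>i < n\<close>, and a partition that is mostly covered by \<open>N\<close> cells has entropy of about \<open>ln N\<close> at most
  (\<open>partition_entropy_le_of_concentrated\<close>).

  Inner regularity provides a compact set \<open>K\<close> of measure close to 1. It has a neighbourhood \<open>W\<close> of
  finite volume. By the choice of \<open>h\<close>, for a fixed small \<open>r\<close> and for all \<open>x \<in> K\<close> outside of a set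
  whose measure tends to 0 with \<open>n\<close>, the condition \<open>T\<^sup>n x \<in> K\<close> implies that the dynamical ball
  \<open>B\<^sub>n(x, r)\<close>, which lies in \<open>W\<close>, has volume at least \<open>e\<^sup>-\<^sup>n\<^sup>h\<close>. As \<open>\<mu>\<close> is invariant, \<open>T\<^sup>n x \<in> K\<close> fails
  with small probability only. Hence, if the balls of one representative in each cell were
  disjoint, there would be at most \<open>vol(W) e\<^sup>n\<^sup>h\<close> cells.

  They need not be disjoint, since close orbits may lie on different sides of the boundary of a
  cell. So each cell \<open>B \<in> P\<close> is replaced by a compact core \<open>C\<^sub>B \<subseteq> B\<close>; the cores are at positive
  distance from each other, and the set \<open>R\<close> missed by them is so small that, by Markov's
  inequality, most points visit \<open>R\<close> fewer than \<open>a n\<close> times before time \<open>n\<close>. If \<open>B\<^sub>n(x, r)\<close> and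
  \<open>B\<^sub>n(y, r)\<close> intersect, then \<open>T\<^sup>i x\<close> and \<open>T\<^sup>i y\<close> lie in the same cell of \<open>P\<close> unless one of them is
  in \<open>R\<close>, so the itineraries of \<open>x\<close> and \<open>y\<close> differ in at most \<open>2 a n\<close> places. The size of such a
  Hamming ball is exponential in \<open>n\<close> with a rate that vanishes as \<open>a \<rightarrow> 0\<close>
  (\<open>card_cells_few_mismatches_le\<close>). It bounds the multiplicity of the overlaps, and therefore costs
  an arbitrarily small exponential factor only (\<open>card_cells_le\<close>).

  Geometry enters through two properties of the Riemannian volume: open sets
  have positive volume, and points have neighbourhoods of finite volume. They make the volumes of
  small dynamical balls positive and finite, so that the limit in the definition of the local entropy
  is a monotone one. That the limit defining \<open>h\<^sub>\<mu>(T, P)\<close> exists is the classical consequence of the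
  subadditivity of the entropies of the joins.
\<close>

section \<open>Entropy of finite partitions\<close>

lemma gibbs_inequality:
  fixes p q :: "'i \<Rightarrow> real"
  assumes p: "\<And>i. i \<in> I \<Longrightarrow> 0 \<le> p i" and q: "\<And>i. i \<in> I \<Longrightarrow> 0 \<le> q i"
    and pq: "\<And>i. i \<in> I \<Longrightarrow> 0 < p i \<Longrightarrow> 0 < q i"
    and le: "sum q I \<le> sum p I"
  shows "- (\<Sum>i\<in>I. p i * ln (p i)) \<le> - (\<Sum>i\<in>I. p i * ln (q i))"
proof -
  have "p i * ln (q i) - p i * ln (p i) \<le> q i - p i" if i: "i \<in> I" for i
  proof (cases "p i = 0")
    case False
    then have pos: "0 < p i" "0 < q i" using p[OF i] pq[OF i] by auto
    then have "p i * ln (q i / p i) \<le> p i * (q i / p i - 1)"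
      by (intro mult_left_mono ln_le_minus_one) auto
    moreover have "p i * (q i / p i - 1) = q i - p i"
      using pos by (simp add: right_diff_distrib)
    ultimately show ?thesis using pos by (simp add: ln_div right_diff_distrib)
  qed (use q[OF i] in simp)
  then have "(\<Sum>i\<in>I. p i * ln (q i) - p i * ln (p i)) \<le> (\<Sum>i\<in>I. q i - p i)"
    by (rule sum_mono)
  then show ?thesis using le by (simp add: sum_subtractf)
qed

definition join :: "'a set set \<Rightarrow> 'a set set \<Rightarrow> 'a set set" where
  "join P Q = {A \<inter> B | A B. A \<in> P \<and> B \<in> Q} - {{}}"

definition preimage_partition :: "'a measure \<Rightarrow> ('a \<Rightarrow> 'a) \<Rightarrow> 'a set set \<Rightarrow> 'a set set" where
  "preimage_partition M f P = (\<lambda>B. f -` B \<inter> space M) ` P - {{}}"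

lemma finite_measurable_partition_disjoint:
  assumes "finite_measurable_partition M P" "A \<in> P" "B \<in> P" "x \<in> A" "x \<in> B"
  shows "A = B"
  using assms unfolding finite_measurable_partition_def partition_on_def disjoint_def by blast

lemma finite_measurable_partition_join:
  assumes P: "finite_measurable_partition M P" and Q: "finite_measurable_partition M Q"
  shows "finite_measurable_partition M (join P Q)"
  unfolding finite_measurable_partition_def
proof (intro conjI partition_onI)
  have eq: "join P Q = (\<lambda>(A, B). A \<inter> B) ` (P \<times> Q) - {{}}"
    by (auto simp: join_def)
  show "finite (join P Q)"
    using P Q by (simp add: eq finite_measurable_partition_def)
  show "join P Q \<subseteq> sets M"
    using P Q by (auto simp: join_def finite_measurable_partition_def)
  show "\<Union> (join P Q) = space M"
    using P Q unfolding finite_measurable_partition_def partition_on_def join_def by blast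
  show "disjnt A B" if "A \<in> join P Q" "B \<in> join P Q" "A \<noteq> B" for A B
    using that finite_measurable_partition_disjoint[OF P] finite_measurable_partition_disjoint[OF Q]
    unfolding join_def disjnt_def by blast
  show "{} \<notin> join P Q" by (simp add: join_def)
qed

lemma finite_measurable_partition_preimage:
  assumes P: "finite_measurable_partition M P" and f: "f \<in> measurable M M"
  shows "finite_measurable_partition M (preimage_partition M f P)"
  unfolding finite_measurable_partition_def
proof (intro conjI partition_onI)
  show "finite (preimage_partition M f P)"
    using P by (simp add: preimage_partition_def finite_measurable_partition_def)
  show "preimage_partition M f P \<subseteq> sets M"
    using P f by (auto simp: preimage_partition_def finite_measurable_partition_def)
  have "\<Union> (preimage_partition M f P) = f -` \<Union>P \<inter> space M"
    by (auto simp: preimage_partition_def)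
  also have "\<Union>P = space M"
    using P by (simp add: finite_measurable_partition_def partition_on_def)
  finally show "\<Union> (preimage_partition M f P) = space M"
    using measurable_space[OF f] by auto
  show "disjnt A B" if "A \<in> preimage_partition M f P" "B \<in> preimage_partition M f P" "A \<noteq> B" for A B
    using that finite_measurable_partition_disjoint[OF P]
    unfolding preimage_partition_def disjnt_def by blast
qed (simp add: preimage_partition_def)

lemma sum_join:
  fixes h :: "'a set \<Rightarrow> 'b::comm_monoid_add"
  assumes P: "finite_measurable_partition M P" and Q: "finite_measurable_partition M Q"
    and h: "h {} = 0"
  shows "sum h (join P Q) = (\<Sum>A\<in>P. \<Sum>B\<in>Q. h (A \<inter> B))"
proof -
  have fin: "finite P" "finite Q" using P Q by (auto simp: finite_measurable_partition_def)
  have eq: "join P Q = (\<lambda>(A, B). A \<inter> B) ` (P \<times> Q) - {{}}"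
    by (auto simp: join_def)
  have "sum h (join P Q) = sum h ((\<lambda>(A, B). A \<inter> B) ` (P \<times> Q))"
    unfolding eq using fin h by (intro sum.mono_neutral_left) auto
  also have "\<dots> = (\<Sum>(A, B)\<in>P \<times> Q. h (A \<inter> B))"
  proof (subst sum.reindex_nontrivial)
    fix x y assume xy: "x \<in> P \<times> Q" "y \<in> P \<times> Q" "x \<noteq> y"
      and same: "(case x of (A, B) \<Rightarrow> A \<inter> B) = (case y of (A, B) \<Rightarrow> A \<inter> B)"
    have "(case x of (A, B) \<Rightarrow> A \<inter> B) = {}"
    proof (rule ccontr)
      assume "(case x of (A, B) \<Rightarrow> A \<inter> B) \<noteq> {}"
      then obtain z where "z \<in> (case x of (A, B) \<Rightarrow> A \<inter> B)" by blast
      then have "x = y"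
        using xy same finite_measurable_partition_disjoint[OF P, of "fst x" "fst y" z]
          finite_measurable_partition_disjoint[OF Q, of "snd x" "snd y" z]
        by (cases x; cases y) simp
      then show False using xy by simp
    qed
    then show "h (case x of (A, B) \<Rightarrow> A \<inter> B) = 0" using h by simp
  qed (use fin in \<open>auto simp: case_prod_beta comp_def\<close>)
  finally show ?thesis by (simp add: sum.cartesian_product)
qed

lemma sum_preimage_partition:
  fixes h :: "'a set \<Rightarrow> 'b::comm_monoid_add"
  assumes P: "finite_measurable_partition M P" and h: "h {} = 0"
  shows "sum h (preimage_partition M f P) = (\<Sum>B\<in>P. h (f -` B \<inter> space M))"
proof -
  have fin: "finite P" using P by (auto simp: finite_measurable_partition_def)
  have "sum h (preimage_partition M f P) = sum h ((\<lambda>B. f -` B \<inter> space M) ` P)"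
    unfolding preimage_partition_def using fin h by (intro sum.mono_neutral_left) auto
  also have "\<dots> = (\<Sum>B\<in>P. h (f -` B \<inter> space M))"
  proof (subst sum.reindex_nontrivial)
    fix A B assume AB: "A \<in> P" "B \<in> P" "A \<noteq> B" "f -` A \<inter> space M = f -` B \<inter> space M"
    then have "f -` A \<inter> space M = {}"
      using finite_measurable_partition_disjoint[OF P AB(1,2)] by blast
    then show "h (f -` A \<inter> space M) = 0" using h by simp
  qed (use fin in \<open>auto simp: comp_def\<close>)
  finally show ?thesis .
qed

lemma (in finite_measure) sum_measure_partition:
  assumes P: "finite_measurable_partition M P" and A: "A \<in> sets M"
  shows "(\<Sum>B\<in>P. measure M (A \<inter> B)) = measure M A"
proof -
  have "measure M (\<Union>B\<in>P. A \<inter> B) = (\<Sum>B\<in>P. measure M (A \<inter> B))"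
    using P A finite_measurable_partition_disjoint[OF P]
    by (intro finite_measure_finite_Union)
       (auto simp: finite_measurable_partition_def disjoint_family_on_def)
  moreover have "(\<Union>B\<in>P. A \<inter> B) = A"
    using P sets.sets_into_space[OF A]
    unfolding finite_measurable_partition_def partition_on_def by blast
  ultimately show ?thesis by simp
qed

lemma (in prob_space) sum_prob_partition:
  assumes P: "finite_measurable_partition M P"
  shows "(\<Sum>B\<in>P. measure M B) = 1"
proof -
  have "space M \<inter> B = B" if "B \<in> P" for B
    using P that unfolding finite_measurable_partition_def partition_on_def by blast
  then show ?thesis
    using sum_measure_partition[OF P, of "space M"] by (simp add: prob_space cong: sum.cong)
qed

text \<open>
  Gibbs' inequality compares the joint distribution of the two partitions with the product of its
  marginals.
\<close>

lemma (in prob_space) partition_entropy_join_le: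
  assumes P: "finite_measurable_partition M P" and Q: "finite_measurable_partition M Q"
  shows "partition_entropy M (join P Q) \<le> partition_entropy M P + partition_entropy M Q"
proof -
  define p where "p = (\<lambda>(A, B). measure M (A \<inter> B))"
  define q where "q = (\<lambda>(A, B). measure M A * measure M B)"
  have sets: "A \<in> sets M" if "A \<in> P \<union> Q" for A
    using that P Q by (auto simp: finite_measurable_partition_def)
  have row: "(\<Sum>B\<in>Q. measure M (A \<inter> B)) = measure M A" if "A \<in> P" for A
    using sum_measure_partition[OF Q sets] that by simp
  have col: "(\<Sum>A\<in>P. measure M (A \<inter> B)) = measure M B" if "B \<in> Q" for B
    using sum_measure_partition[OF P sets, of B] that by (simp add: Int_commute)
  have pos: "0 < measure M A \<and> 0 < measure M B"
    if "A \<in> P" "B \<in> Q" "0 < measure M (A \<inter> B)" for A B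
    using that sets finite_measure_mono[of "A \<inter> B" A] finite_measure_mono[of "A \<inter> B" B] by auto
  have sum_p: "sum p (P \<times> Q) = 1"
    using row sum_prob_partition[OF P]
    by (simp add: p_def sum.cartesian_product[symmetric])
  have sum_q: "sum q (P \<times> Q) = 1"
    using sum_prob_partition[OF P] sum_prob_partition[OF Q]
    by (simp add: q_def sum.cartesian_product[symmetric] sum_distrib_left[symmetric])
  have "partition_entropy M (join P Q) = - (\<Sum>i\<in>P \<times> Q. p i * ln (p i))"
    unfolding partition_entropy_def
    by (subst sum_join[OF P Q]) (simp_all add: p_def sum.cartesian_product case_prod_beta)
  also have "\<dots> \<le> - (\<Sum>i\<in>P \<times> Q. p i * ln (q i))"
    using pos by (intro gibbs_inequality) (auto simp: sum_p sum_q, auto simp: p_def q_def)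
  also have "(\<Sum>i\<in>P \<times> Q. p i * ln (q i)) =
      (\<Sum>i\<in>P \<times> Q. case i of (A, B) \<Rightarrow>
        measure M (A \<inter> B) * ln (measure M A) + measure M (A \<inter> B) * ln (measure M B))"
  proof (intro sum.cong refl)
    fix i assume "i \<in> P \<times> Q"
    then obtain A B where AB: "i = (A, B)" "A \<in> P" "B \<in> Q" by auto
    show "p i * ln (q i) = (case i of (A, B) \<Rightarrow>
        measure M (A \<inter> B) * ln (measure M A) + measure M (A \<inter> B) * ln (measure M B))"
      using pos[OF AB(2,3)] AB(1)
      by (cases "measure M (A \<inter> B) = 0")
         (auto simp: p_def q_def zero_less_measure_iff ln_mult distrib_left less_le)
  qed
  also have "\<dots> = (\<Sum>A\<in>P. \<Sum>B\<in>Q. measure M (A \<inter> B) * ln (measure M A)) +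
      (\<Sum>B\<in>Q. \<Sum>A\<in>P. measure M (A \<inter> B) * ln (measure M B))"
    by (subst (2) sum.swap) (simp add: sum.cartesian_product[symmetric] sum.distrib)
  also have "\<dots> = (\<Sum>A\<in>P. measure M A * ln (measure M A)) + (\<Sum>B\<in>Q. measure M B * ln (measure M B))"
    by (simp add: row col sum_distrib_right[symmetric])
  finally show ?thesis by (simp add: partition_entropy_def)
qed

lemma (in prob_space) partition_entropy_nonneg:
  assumes "P \<subseteq> sets M"
  shows "0 \<le> partition_entropy M P"
proof -
  have "measure M B * ln (measure M B) \<le> 0" if "B \<in> P" for B
    by (cases "measure M B = 0") (auto intro!: mult_nonneg_nonpos simp: zero_less_measure_iff)
  then show ?thesis by (simp add: partition_entropy_def sum_nonpos)
qed

text \<open>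
  Half of the mass is spread evenly over the cells of \<open>J'\<close> and half over the other ones; then
  Gibbs' inequality bounds the entropy by the expected code length for this distribution.
  The set \<open>J'\<close> has to be nonempty for \<open>ln L\<close> to be nonnegative.
\<close>

lemma (in prob_space) partition_entropy_le_of_concentrated:
  assumes J: "finite_measurable_partition M J" and J': "J' \<subseteq> J" "J' \<noteq> {}"
    and L: "real (card J') \<le> L" and N: "real (card J) \<le> N"
  shows "partition_entropy M J \<le> ln 2 + ln L + measure M (\<Union>(J - J')) * ln N"
proof -
  have fin: "finite J" "finite J'" using J J' finite_subset by (auto simp: finite_measurable_partition_def)
  have c: "1 \<le> card J'" "1 \<le> card J"
    using J' fin by (auto simp: Suc_le_eq card_gt_0_iff)
  then have L1: "1 \<le> L" and N1: "1 \<le> N" using L N by linarith+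
  \<comment> \<open>Its total mass is at most 1, as \<open>J'\<close> has at most \<open>L\<close> cells and \<open>J - J'\<close> at most \<open>N\<close>.\<close>
  define q where "q C = (if C \<in> J' then 1 / (2 * L) else 1 / (2 * N))" for C
  have split: "sum h J = sum h J' + sum h (J - J')" for h :: "'a set \<Rightarrow> real"
    using sum.subset_diff[OF J'(1) fin(1), of h] by simp
  have "real (card (J - J')) \<le> N"
    using N card_mono[OF fin(1), of "J - J'"] by simp
  then have "sum q J \<le> 1/2 + 1/2"
    unfolding split[of q] using L L1 N1
    by (intro add_mono) (auto simp: q_def divide_simps)
  then have "- (\<Sum>C\<in>J. measure M C * ln (measure M C)) \<le> - (\<Sum>C\<in>J. measure M C * ln (q C))"
    using L1 N1 by (intro gibbs_inequality) (auto simp: q_def sum_prob_partition[OF J])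
  also have "- (\<Sum>C\<in>J. measure M C * ln (q C)) =
      (\<Sum>C\<in>J'. measure M C * (ln 2 + ln L)) + (\<Sum>C\<in>J - J'. measure M C * (ln 2 + ln N))"
    unfolding split[of "\<lambda>C. measure M C * ln (q C)"] using L1 N1
    by (simp add: q_def ln_div ln_mult sum_negf[symmetric] algebra_simps)
  also have "\<dots> = (\<Sum>C\<in>J. measure M C) * ln 2 + (\<Sum>C\<in>J'. measure M C) * ln L + (\<Sum>C\<in>J - J'. measure M C) * ln N"
    unfolding split[of "measure M"] by (simp add: sum.distrib sum_distrib_left sum_distrib_right algebra_simps)
  also have "(\<Sum>C\<in>J - J'. measure M C) = measure M (\<Union>(J - J'))"
  proof -
    have "disjoint_family_on (\<lambda>C. C) (J - J')"
      using J unfolding finite_measurable_partition_def partition_on_def disjoint_def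
        disjoint_family_on_def by blast
    moreover have "J - J' \<subseteq> sets M" using J by (auto simp: finite_measurable_partition_def)
    ultimately show ?thesis
      using fin finite_measure_finite_Union[of "J - J'" "\<lambda>C. C"] by simp
  qed
  also have "(\<Sum>C\<in>J'. measure M C) * ln L \<le> 1 * ln L"
    using L1 sum_prob_partition[OF J] split[of "measure M"]
      sum_nonneg[of "J - J'" "measure M"]
    by (intro mult_right_mono) auto
  finally show ?thesis by (simp add: partition_entropy_def sum_prob_partition[OF J])
qed

section \<open>Iterated joins and existence of the entropy of a partition\<close>

lemma measurable_funpow:
  assumes "T \<in> measurable M M"
  shows "T ^^ n \<in> measurable M M"
  using assms by (induction n) (auto intro: measurable_comp)

lemma measure_funpow_vimage:
  assumes "invariant_measure T M" "B \<in> sets M"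
  shows "measure M ((T ^^ n) -` B \<inter> space M) = measure M B"
proof (induction n)
  case 0
  then show ?case using sets.sets_into_space[OF assms(2)] by (simp add: Int_absorb2)
next
  case (Suc n)
  have T: "T \<in> measurable M M" "distr M M T = M"
    using assms(1) by (auto simp: invariant_measure_def)
  define C where "C = (T ^^ n) -` B \<inter> space M"
  have C: "C \<in> sets M"
    unfolding C_def using measurable_funpow[OF T(1)] assms(2) by (rule measurable_sets)
  have "(T ^^ Suc n) -` B \<inter> space M = T -` C \<inter> space M"
    using measurable_space[OF T(1)] unfolding funpow_Suc_right by (auto simp: C_def)
  moreover have "measure M (T -` C \<inter> space M) = measure M C"
    using measure_distr[OF T(1), of C] T C by simp
  ultimately show ?case using Suc unfolding C_def by (simp del: funpow.simps)
qed

lemma partition_entropy_preimage: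
  assumes T: "invariant_measure T M" and P: "finite_measurable_partition M P"
  shows "partition_entropy M (preimage_partition M (T ^^ n) P) = partition_entropy M P"
proof -
  have "measure M ((T ^^ n) -` B \<inter> space M) = measure M B" if "B \<in> P" for B
    using that P by (intro measure_funpow_vimage[OF T]) (auto simp: finite_measurable_partition_def)
  then show ?thesis
    unfolding partition_entropy_def
    by (subst sum_preimage_partition[OF P]) auto
qed

lemma mem_join_iff: "C \<in> join P Q \<longleftrightarrow> C \<noteq> {} \<and> (\<exists>A\<in>P. \<exists>B\<in>Q. C = A \<inter> B)"
  by (auto simp: join_def)

lemma mem_preimage_partition_iff:
  "C \<in> preimage_partition M f P \<longleftrightarrow> C \<noteq> {} \<and> (\<exists>B\<in>P. C = f -` B \<inter> space M)"
  by (auto simp: preimage_partition_def)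

lemma bex_join_iff:
  "(\<exists>C\<in>join P Q. \<phi> C) \<longleftrightarrow> (\<exists>A\<in>P. \<exists>B\<in>Q. A \<inter> B \<noteq> {} \<and> \<phi> (A \<inter> B))"
  by (auto simp: join_def)

lemma bex_preimage_partition_iff:
  "(\<exists>C\<in>preimage_partition M f P. \<phi> C) \<longleftrightarrow>
    (\<exists>B\<in>P. f -` B \<inter> space M \<noteq> {} \<and> \<phi> (f -` B \<inter> space M))"
  by (auto simp: preimage_partition_def)

lemma join_assoc: "join (join P Q) R = join P (join Q R)"
  by (intro set_eqI) (fastforce simp: mem_join_iff bex_join_iff Int_assoc)

lemma preimage_partition_join:
  "preimage_partition M f (join P Q) = join (preimage_partition M f P) (preimage_partition M f Q)"
proof (intro set_eqI)
  fix X
  have eq: "(f -` A \<inter> space M) \<inter> (f -` B \<inter> space M) = f -` (A \<inter> B) \<inter> space M" for A B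
    by blast
  show "X \<in> preimage_partition M f (join P Q) \<longleftrightarrow>
      X \<in> join (preimage_partition M f P) (preimage_partition M f Q)"
    unfolding mem_preimage_partition_iff mem_join_iff bex_join_iff bex_preimage_partition_iff eq
    by blast
qed

lemma preimage_partition_preimage:
  assumes "f \<in> measurable M M"
  shows "preimage_partition M f (preimage_partition M g P) = preimage_partition M (g \<circ> f) P"
proof (intro set_eqI)
  fix X
  have eq: "f -` (g -` B \<inter> space M) \<inter> space M = (g \<circ> f) -` B \<inter> space M" for B
    using measurable_space[OF assms] by auto
  have ne: "g -` B \<inter> space M \<noteq> {}" if "(g \<circ> f) -` B \<inter> space M \<noteq> {}" for B
    using that unfolding eq[symmetric] by blast
  show "X \<in> preimage_partition M f (preimage_partition M g P) \<longleftrightarrow>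
      X \<in> preimage_partition M (g \<circ> f) P"
    unfolding mem_preimage_partition_iff bex_preimage_partition_iff eq by (metis ne)
qed

lemma iterated_join_partition:
  assumes M: "space M \<noteq> {}" and T: "T \<in> measurable M M" and P: "finite_measurable_partition M P"
  shows "finite_measurable_partition M (iterated_join M T P n)"
    and "iterated_join M T P (Suc n) = join (iterated_join M T P n) (preimage_partition M (T ^^ n) P)"
proof -
  have step: "iterated_join M T P (Suc n) = join (iterated_join M T P n) (preimage_partition M (T ^^ n) P)"
    if "\<Union>(iterated_join M T P n) = space M" for n
  proof -
    have eq: "A \<inter> ((T ^^ n) -` B \<inter> space M) = A \<inter> (T ^^ n) -` B"
      if "A \<in> iterated_join M T P n" for A B
      using that \<open>\<Union>(iterated_join M T P n) = space M\<close> by blast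
    show ?thesis
    proof (intro set_eqI)
      fix X
      have "X \<in> iterated_join M T P (Suc n) \<longleftrightarrow>
          X \<noteq> {} \<and> (\<exists>A\<in>iterated_join M T P n. \<exists>B\<in>P. X = A \<inter> ((T ^^ n) -` B \<inter> space M))"
        using eq by fastforce
      then show "X \<in> iterated_join M T P (Suc n) \<longleftrightarrow>
          X \<in> join (iterated_join M T P n) (preimage_partition M (T ^^ n) P)"
        unfolding mem_join_iff bex_preimage_partition_iff by blast
    qed
  qed
  have part: "finite_measurable_partition M (iterated_join M T P n)" for n
  proof (induction n)
    case 0
    then show ?case using M by (auto simp: finite_measurable_partition_def partition_on_def)
  next
    case (Suc n)
    then have "\<Union>(iterated_join M T P n) = space M"
      by (simp add: finite_measurable_partition_def partition_on_def)
    then show ?case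
      unfolding step[OF \<open>\<Union>(iterated_join M T P n) = space M\<close>]
      by (intro finite_measurable_partition_join Suc finite_measurable_partition_preimage P
          measurable_funpow T)
  qed
  then show "finite_measurable_partition M (iterated_join M T P n)" .
  show "iterated_join M T P (Suc n) = join (iterated_join M T P n) (preimage_partition M (T ^^ n) P)"
    using part[of n] by (intro step) (simp add: finite_measurable_partition_def partition_on_def)
qed

text \<open>
  The itinerary of length \<open>n + m\<close> of \<open>x\<close> consists of that of length \<open>n\<close> of \<open>x\<close> and that of length
  \<open>m\<close> of \<open>T\<^sup>n x\<close>.
\<close>

lemma iterated_join_add:
  assumes M: "space M \<noteq> {}" and T: "T \<in> measurable M M" and P: "finite_measurable_partition M P"
  shows "iterated_join M T P (n + m) =
    join (iterated_join M T P n) (preimage_partition M (T ^^ n) (iterated_join M T P m))"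
proof (induction m)
  case 0
  have J: "finite_measurable_partition M (iterated_join M T P n)"
    using iterated_join_partition[OF assms] by simp
  have "preimage_partition M (T ^^ n) {space M} = {space M}"
    using M measurable_space[OF measurable_funpow[OF T]] by (auto simp: preimage_partition_def)
  moreover have "join (iterated_join M T P n) {space M} = iterated_join M T P n"
  proof -
    have "A \<inter> space M = A \<and> A \<noteq> {}" if "A \<in> iterated_join M T P n" for A
      using J that unfolding finite_measurable_partition_def partition_on_def by blast
    then show ?thesis by (fastforce simp: join_def)
  qed
  ultimately show ?case by simp
next
  case (Suc m)
  have "iterated_join M T P (n + Suc m) =
      join (iterated_join M T P (n + m)) (preimage_partition M (T ^^ (n + m)) P)"
    using iterated_join_partition(2)[OF assms, of "n + m"] by simp
  also have "preimage_partition M (T ^^ (n + m)) P =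
      preimage_partition M (T ^^ n) (preimage_partition M (T ^^ m) P)"
    using preimage_partition_preimage[OF measurable_funpow[OF T], of n "T ^^ m" P]
    by (simp add: funpow_add[symmetric] add.commute)
  finally show ?case
    unfolding Suc iterated_join_partition(2)[OF assms, of m]
    by (simp add: join_assoc preimage_partition_join)
qed

lemma (in prob_space) partition_entropy_iterated_join_add_le:
  assumes T: "invariant_measure T M" and P: "finite_measurable_partition M P"
  shows "partition_entropy M (iterated_join M T P (n + m)) \<le>
    partition_entropy M (iterated_join M T P n) + partition_entropy M (iterated_join M T P m)"
proof -
  have Tm: "T \<in> measurable M M" using T by (simp add: invariant_measure_def)
  note J = iterated_join_partition(1)[OF not_empty Tm P]
  have "partition_entropy M (iterated_join M T P (n + m)) \<le> partition_entropy M (iterated_join M T P n) +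
      partition_entropy M (preimage_partition M (T ^^ n) (iterated_join M T P m))"
    unfolding iterated_join_add[OF not_empty Tm P]
    by (intro partition_entropy_join_le J finite_measurable_partition_preimage measurable_funpow Tm)
  then show ?thesis by (simp add: partition_entropy_preimage[OF T J])
qed

text \<open>
  For a fixed \<open>m\<close>, division with remainder \<open>n = q m + r\<close> shows that \<open>u n / n\<close> exceeds \<open>u m / m\<close> by
  at most \<open>O(1 / n)\<close>. So the limit is the infimum of these quotients.
\<close>

lemma fekete:
  fixes u :: "nat \<Rightarrow> real"
  assumes sub: "\<And>m n. u (m + n) \<le> u m + u n" and nonneg: "\<And>n. 0 \<le> u n"
  shows "convergent (\<lambda>n. u n / n)"
proof -
  define l where "l = (INF n\<in>{1..}. u n / real n)"
  have bdd: "bdd_below ((\<lambda>n. u n / real n) ` {1..})"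
    by (intro bdd_belowI[of _ 0]) (auto simp: nonneg)
  have lower: "l \<le> u n / real n" if "n \<ge> 1" for n
    unfolding l_def using that by (intro cINF_lower bdd) auto
  have mult: "u (q * m + r) \<le> real q * u m + u r" for q m r
  proof (induction q)
    case (Suc q)
    have "u (Suc q * m + r) \<le> u m + u (q * m + r)"
      using sub[of m "q * m + r"] by (simp add: add.assoc)
    then show ?case using Suc by (simp add: distrib_right)
  qed simp
  have "(\<lambda>n. u n / real n) \<longlonglongrightarrow> l"
  proof (rule LIMSEQ_I)
    fix e :: real assume e: "0 < e"
    obtain m where m: "m \<ge> 1" "u m / real m < l + e / 2"
      using cINF_less_iff[of "{1..}" "\<lambda>n. u n / real n" "l + e / 2"] bdd e
      by (auto simp: l_def)
    define C where "C = (\<Sum>r<m. u r)"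
    obtain N where N: "real N > 2 * C / e" using reals_Archimedean2 by blast
    have "norm (u n / real n - l) < e" if n: "n \<ge> max 1 N" for n
    proof -
      define q r where "q = n div m" and "r = n mod m"
      have qr: "n = q * m + r" "r < m" using m by (auto simp: q_def r_def)
      have "u r \<le> C" unfolding C_def using qr nonneg by (intro member_le_sum) auto
      then have "u n \<le> real q * u m + C" using mult[of q m r] qr by simp
      also have "real q * u m = real (q * m) * (u m / real m)" using m by simp
      also have "\<dots> \<le> real n * (u m / real m)"
        using qr nonneg by (intro mult_right_mono) auto
      finally have "u n / real n \<le> u m / real m + C / real n"
        using n by (simp add: field_simps)
      moreover have "C / real n < e / 2"
      proof -
        have "2 * C / e < real n" using N n by (smt (verit) max.bounded_iff of_nat_mono)
        then show ?thesis using e n by (simp add: field_simps)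
      qed
      ultimately have "u n / real n < l + e" using m by linarith
      then show ?thesis using lower[of n] n by simp
    qed
    then show "\<exists>N. \<forall>n\<ge>N. norm (u n / real n - l) < e" by blast
  qed
  then show ?thesis by (rule convergentI)
qed

lemma (in prob_space) entropy_wrt_partition_LIMSEQ:
  assumes T: "invariant_measure T M" and P: "finite_measurable_partition M P"
  obtains l where "(\<lambda>n. partition_entropy M (iterated_join M T P n) / real n) \<longlonglongrightarrow> l"
    and "entropy_wrt_partition M T P = ereal l"
proof -
  have Tm: "T \<in> measurable M M" using T by (simp add: invariant_measure_def)
  note J = iterated_join_partition(1)[OF not_empty Tm P]
  have "convergent (\<lambda>n. partition_entropy M (iterated_join M T P n) / real n)"
    using J by (intro fekete partition_entropy_iterated_join_add_le[OF T P] partition_entropy_nonneg)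
      (auto simp: finite_measurable_partition_def)
  then obtain l where l: "(\<lambda>n. partition_entropy M (iterated_join M T P n) / real n) \<longlonglongrightarrow> l"
    by (auto simp: convergent_def)
  then have "entropy_wrt_partition M T P = ereal l"
    unfolding entropy_wrt_partition_def by (intro limI) simp
  with l that show ?thesis by blast
qed

section \<open>Counting cells by volume\<close>

text \<open>
  The cardinality of this set is the Hamming distance between the \<open>P\<close>-itineraries of length \<open>n\<close>
  of \<open>x\<close> and \<open>y\<close>.
\<close>

definition mismatches :: "('a \<Rightarrow> 'a) \<Rightarrow> 'a set set \<Rightarrow> nat \<Rightarrow> 'a \<Rightarrow> 'a \<Rightarrow> nat set" where
  "mismatches T P n x y = {i. i < n \<and> \<not> (\<exists>B\<in>P. (T ^^ i) x \<in> B \<and> (T ^^ i) y \<in> B)}"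

text \<open>
  The generating function of the Hamming distance to the itinerary of \<open>x\<close>: each time contributes a
  factor 1 for the cell of \<open>T\<^sup>i x\<close> and a factor \<open>t\<close> for each other cell of \<open>P\<close>. The points of a
  cell \<open>C\<close> all have the same mismatches with \<open>x\<close>; the intersection over \<open>y \<in> C\<close> expresses their
  common value without choosing a point of \<open>C\<close>, and that it can only grow as \<open>C\<close> shrinks is what
  the induction uses.
\<close>

lemma sum_power_card_mismatches_le:
  fixes t :: real
  assumes M: "space M \<noteq> {}" and T: "T \<in> measurable M M" and P: "finite_measurable_partition M P"
    and t: "0 \<le> t" "t \<le> 1"
  shows "(\<Sum>C\<in>iterated_join M T P n. t ^ card (\<Inter>y\<in>C. mismatches T P n x y)) \<le> (1 + card P * t) ^ n"
proof (induction n)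
  case 0
  show ?case using M by (simp add: mismatches_def)
next
  case (Suc n)
  define h where "h n C = card (\<Inter>y\<in>C. mismatches T P n x y)" for n C
  define w where "w B = (if (T ^^ n) x \<in> B then 1 else t)" for B
  let ?J = "iterated_join M T P n"
  let ?c = "\<lambda>(A, B). A \<inter> (T ^^ n) -` B"
  define I where "I = {i \<in> ?J \<times> P. ?c i \<noteq> {}}"
  have J: "finite_measurable_partition M ?J"
    using iterated_join_partition[OF M T P] by simp
  have fin: "finite ?J" "finite P" using J P by (auto simp: finite_measurable_partition_def)
  then have finI: "finite I" by (simp add: I_def)
  have w: "0 \<le> w B" for B using t by (simp add: w_def)
  have weight: "t ^ h (Suc n) (?c (A, B)) \<le> t ^ h n A * w B" if "(A, B) \<in> I" for A B
  proof -
    from that have AB: "A \<in> ?J" "B \<in> P" "A \<inter> (T ^^ n) -` B \<noteq> {}" by (auto simp: I_def)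
    define D where "D = (\<Inter>y\<in>A. mismatches T P n x y)"
    define E where "E = (\<Inter>y\<in>A \<inter> (T ^^ n) -` B. mismatches T P (Suc n) x y)"
    have "E \<subseteq> {..<Suc n}" using AB(3) by (auto simp: E_def mismatches_def)
    then have finE: "finite E" by (rule finite_subset) simp
    have DE: "D \<subseteq> E" by (auto simp: D_def E_def mismatches_def less_Suc_eq)
    have nD: "n \<notin> D" using AB(3) by (auto simp: D_def mismatches_def)
    show ?thesis
    proof (cases "(T ^^ n) x \<in> B")
      case True
      then show ?thesis
        using t card_mono[OF finE DE] by (simp add: w_def h_def D_def E_def power_decreasing)
    next
      case False
      then have "n \<in> E"
        using finite_measurable_partition_disjoint[OF P _ AB(2)] by (fastforce simp: E_def mismatches_def)
      then have "Suc (card D) \<le> card E"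
        using DE finE nD card_mono[of E "insert n D"] finite_subset[OF DE finE] by simp
      then have "t ^ card E \<le> t ^ Suc (card D)" using t by (intro power_decreasing) auto
      then show ?thesis using False by (simp add: w_def h_def D_def E_def mult.commute)
    qed
  qed
  have "(\<Sum>C\<in>iterated_join M T P (Suc n). t ^ h (Suc n) C) = (\<Sum>C\<in>?c ` I. t ^ h (Suc n) C)"
    by (intro sum.cong) (auto simp: I_def)
  also have "\<dots> \<le> (\<Sum>i\<in>I. t ^ h (Suc n) (?c i))"
    using sum_image_le[OF finI, of "\<lambda>C. t ^ h (Suc n) C" ?c] t by (simp add: comp_def)
  also have "\<dots> \<le> (\<Sum>(A, B)\<in>I. t ^ h n A * w B)"
    using weight by (intro sum_mono) auto
  also have "\<dots> \<le> (\<Sum>(A, B)\<in>?J \<times> P. t ^ h n A * w B)"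
    using fin w t by (intro sum_mono2) (auto simp: I_def)
  also have "\<dots> = (\<Sum>A\<in>?J. t ^ h n A) * (\<Sum>B\<in>P. w B)"
    by (simp add: sum_product sum.cartesian_product)
  also have "\<dots> \<le> (1 + card P * t) ^ n * (1 + card P * t)"
  proof (intro mult_mono)
    have "(\<Sum>B\<in>P. w B) \<le> (\<Sum>B\<in>P. (if (T ^^ n) x \<in> B then 1 else 0) + t)"
      using t by (intro sum_mono) (simp add: w_def)
    also have "\<dots> = card {B \<in> P. (T ^^ n) x \<in> B} + card P * t"
      using fin by (simp add: sum.distrib sum.If_cases Int_def)
    also have "card {B \<in> P. (T ^^ n) x \<in> B} \<le> Suc 0"
      using fin finite_measurable_partition_disjoint[OF P] by (subst card_le_Suc0_iff_eq) auto
    finally show "(\<Sum>B\<in>P. w B) \<le> 1 + card P * t" by simp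
  qed (use Suc w t in \<open>auto simp: h_def intro!: sum_nonneg\<close>)
  finally show ?case by (simp add: h_def mult.commute)
qed

text \<open>
  Chernoff's bound for the size of a Hamming ball. For \<open>m = 2 a n\<close> the exponential rate is
  \<open>ln (1 + k t) - 2 a ln t\<close>; it becomes small on choosing first \<open>t\<close> and then \<open>a\<close> small.
\<close>

lemma card_cells_few_mismatches_le:
  fixes t m :: real
  assumes M: "space M \<noteq> {}" and T: "T \<in> measurable M M" and P: "finite_measurable_partition M P"
    and t: "0 < t" "t \<le> 1"
  shows "card {C \<in> iterated_join M T P n. \<exists>y\<in>C. card (mismatches T P n x y) \<le> m}
    \<le> (1 + card P * t) ^ n * t powr (- m)"
proof -
  let ?J = "iterated_join M T P n"
  define S where "S = {C \<in> ?J. \<exists>y\<in>C. card (mismatches T P n x y) \<le> m}"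
  have fin: "finite ?J"
    using iterated_join_partition(1)[OF M T P] by (simp add: finite_measurable_partition_def)
  have "t powr m \<le> t ^ card (\<Inter>y\<in>C. mismatches T P n x y)" if "C \<in> S" for C
  proof -
    from that obtain y where y: "y \<in> C" "card (mismatches T P n x y) \<le> m" by (auto simp: S_def)
    have "card (\<Inter>y\<in>C. mismatches T P n x y) \<le> card (mismatches T P n x y)"
      using y(1) by (intro card_mono) (auto simp: mismatches_def)
    then have "t powr m \<le> t powr card (\<Inter>y\<in>C. mismatches T P n x y)"
      using y(2) t by (intro powr_mono') auto
    then show ?thesis using t by (simp add: powr_realpow)
  qed
  then have "card S * t powr m \<le> (\<Sum>C\<in>S. t ^ card (\<Inter>y\<in>C. mismatches T P n x y))"
    by (rule sum_bounded_below)
  also have "\<dots> \<le> (\<Sum>C\<in>?J. t ^ card (\<Inter>y\<in>C. mismatches T P n x y))"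
    using fin t by (intro sum_mono2) (auto simp: S_def)
  also have "\<dots> \<le> (1 + card P * t) ^ n"
    using sum_power_card_mismatches_le[OF M T P] t by simp
  finally show ?thesis using t by (simp add: S_def powr_minus field_simps)
qed

text \<open>
  Integrate the number of sets \<open>b i\<close> that contain a given point. All sets that contain it
  meet any one of them, so this number is at most \<open>H\<close>.
\<close>

lemma sum_measure_le_of_bounded_overlap:
  assumes I: "finite I" and b: "\<And>i. i \<in> I \<Longrightarrow> b i \<in> sets L" "\<And>i. i \<in> I \<Longrightarrow> b i \<subseteq> W"
    and W: "W \<in> sets L" "emeasure L W < \<infinity>" and H: "0 \<le> H"
    and overlap: "\<And>i. i \<in> I \<Longrightarrow> real (card {j \<in> I. b i \<inter> b j \<noteq> {}}) \<le> H"
  shows "(\<Sum>i\<in>I. measure L (b i)) \<le> H * measure L W"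
proof -
  have fin: "emeasure L (b i) < \<infinity>" if "i \<in> I" for i
    using emeasure_mono[OF b(2)[OF that] W(1)] W(2) by (rule order.strict_trans1)
  have "(\<Sum>i\<in>I. measure L (b i)) = (\<integral>z. (\<Sum>i\<in>I. indicator (b i) z) \<partial>L)"
    using b fin sets.sets_into_space by (subst Bochner_Integration.integral_sum) (auto simp: Int_absorb2)
  also have "\<dots> \<le> (\<integral>z. H * indicator W z \<partial>L)"
  proof (rule integral_mono)
    show "integrable L (\<lambda>z. \<Sum>i\<in>I. indicator (b i) z :: real)" using b fin by auto
    show "integrable L (\<lambda>z. H * indicator W z)" using W by auto
    fix z
    have "(\<Sum>i\<in>I. indicator (b i) z :: real) = card {i \<in> I. z \<in> b i}"
      using I by (simp add: indicator_def sum.If_cases Int_def)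
    also have "\<dots> \<le> H * indicator W z"
    proof (cases "\<exists>i\<in>I. z \<in> b i")
      case True
      then obtain i where i: "i \<in> I" "z \<in> b i" by blast
      have "card {i \<in> I. z \<in> b i} \<le> card {j \<in> I. b i \<inter> b j \<noteq> {}}"
        using I i by (intro card_mono) auto
      then show ?thesis using overlap[OF i(1)] b(2)[OF i(1)] i by auto
    next
      case False
      then have eq: "{i \<in> I. z \<in> b i} = {}" by blast
      show ?thesis unfolding eq using H by simp
    qed
    finally show "(\<Sum>i\<in>I. indicator (b i) z) \<le> H * indicator W z" .
  qed
  also have "\<dots> = H * measure L W" using W sets.sets_into_space by (simp add: Int_absorb2)
  finally show ?thesis .
qed

text \<open>
  One representative in \<open>G\<close> is picked from each cell that meets \<open>G\<close>. If the set \<open>b x\<close> of a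
  representative \<open>x\<close> meets those of others, then the cells of these others lie in a Hamming ball
  about the itinerary of \<open>x\<close>.
\<close>

lemma card_cells_le:
  fixes t m c :: real
  assumes M: "space M \<noteq> {}" and T: "T \<in> measurable M M" and P: "finite_measurable_partition M P"
    and t: "0 < t" "t \<le> 1"
    and b: "\<And>x. x \<in> G \<Longrightarrow> b x \<in> sets L" "\<And>x. x \<in> G \<Longrightarrow> b x \<subseteq> W" "\<And>x. x \<in> G \<Longrightarrow> c \<le> measure L (b x)"
    and W: "W \<in> sets L" "emeasure L W < \<infinity>"
    and close: "\<And>x y. x \<in> G \<Longrightarrow> y \<in> G \<Longrightarrow> b x \<inter> b y \<noteq> {} \<Longrightarrow> card (mismatches T P n x y) \<le> m"
  shows "card {C \<in> iterated_join M T P n. C \<inter> G \<noteq> {}} * c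
    \<le> (1 + card P * t) ^ n * t powr (- m) * measure L W"
proof -
  define J where "J = {C \<in> iterated_join M T P n. C \<inter> G \<noteq> {}}"
  have fin: "finite (iterated_join M T P n)"
    using iterated_join_partition(1)[OF M T P] by (simp add: finite_measurable_partition_def)
  have "\<forall>C\<in>J. \<exists>x. x \<in> C \<inter> G" by (auto simp: J_def)
  then obtain p where p: "\<And>C. C \<in> J \<Longrightarrow> p C \<in> C" "\<And>C. C \<in> J \<Longrightarrow> p C \<in> G"
    unfolding bchoice_iff by auto
  have "card J * c \<le> (\<Sum>C\<in>J. measure L (b (p C)))"
    using b(3) p by (intro sum_bounded_below) auto
  also have "\<dots> \<le> (1 + card P * t) ^ n * t powr (- m) * measure L W"
  proof (rule sum_measure_le_of_bounded_overlap)
    fix C assume C: "C \<in> J"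
    have "card {D \<in> J. b (p C) \<inter> b (p D) \<noteq> {}} \<le>
        card {D \<in> iterated_join M T P n. \<exists>y\<in>D. card (mismatches T P n (p C) y) \<le> m}"
    proof (intro card_mono subsetI)
      fix D assume "D \<in> {D \<in> J. b (p C) \<inter> b (p D) \<noteq> {}}"
      then have D: "D \<in> J" "b (p C) \<inter> b (p D) \<noteq> {}" by auto
      then have "card (mismatches T P n (p C) (p D)) \<le> m" using close p C by blast
      then show "D \<in> {D \<in> iterated_join M T P n. \<exists>y\<in>D. card (mismatches T P n (p C) y) \<le> m}"
        using D(1) p(1)[OF D(1)] by (auto simp: J_def)
    qed (use fin in simp)
    then show "card {D \<in> J. b (p C) \<inter> b (p D) \<noteq> {}} \<le> (1 + card P * t) ^ n * t powr (- m)"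
      using card_cells_few_mismatches_le[OF M T P t, of n "p C" m] by linarith
  next
    show "finite J" using fin by (simp add: J_def)
    show "b (p C) \<in> sets L" "b (p C) \<subseteq> W" if "C \<in> J" for C
      using b(1,2) p(2)[OF that] by blast+
    show "0 \<le> (1 + card P * t) ^ n * t powr (- m)" using t by simp
  qed (use W in auto)
  finally show ?thesis by (simp add: J_def)
qed

section \<open>Positivity and local finiteness of the Riemannian volume\<close>

lemma continuous_on_det:
  fixes A :: "'a::topological_space \<Rightarrow> real ^ 'n ^ 'n"
  assumes "continuous_on S A"
  shows "continuous_on S (\<lambda>x. det (A x))"
  unfolding det_def by (intro continuous_intros assms)

text \<open>
  The matrices on the segment from the identity to \<open>A\<close> are positive definite, hence invertible, so
  the determinant does not change its sign along it.
\<close>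

lemma det_pos_of_positive_definite:
  fixes A :: "real ^ 'n ^ 'n"
  assumes A: "\<And>v. v \<noteq> 0 \<Longrightarrow> 0 < v \<bullet> (A *v v)"
  shows "0 < det A"
proof -
  define B where "B s = (1 - s) *\<^sub>R mat 1 + s *\<^sub>R A" for s :: real
  have nz: "det (B s) \<noteq> 0" if s: "0 \<le> s" "s \<le> 1" for s
  proof -
    have "v = 0" if v: "B s *v v = 0" for v
    proof (rule ccontr)
      assume "v \<noteq> 0"
      have "v \<bullet> (B s *v v) = (1 - s) * (v \<bullet> v) + s * (v \<bullet> (A *v v))"
        by (simp add: B_def matrix_vector_mult_add_rdistrib scaleR_matrix_vector_assoc[symmetric]
            inner_add_right)
      moreover have "0 < (1 - s) * (v \<bullet> v) + s * (v \<bullet> (A *v v))"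
      proof (cases "s = 0")
        case True
        then show ?thesis using \<open>v \<noteq> 0\<close> by simp
      next
        case False
        then have "0 < s * (v \<bullet> (A *v v))" using A[OF \<open>v \<noteq> 0\<close>] s by simp
        moreover have "0 \<le> (1 - s) * (v \<bullet> v)" using s by simp
        ultimately show ?thesis by linarith
      qed
      ultimately show False using v by simp
    qed
    then show ?thesis
      using invertible_det_nz invertible_left_inverse matrix_left_invertible_ker by metis
  qed
  have cont: "continuous_on {0..1} (\<lambda>s. det (B s))"
    unfolding B_def by (intro continuous_on_det continuous_intros)
  show ?thesis
  proof (rule ccontr)
    assume "\<not> 0 < det A"
    then have "\<exists>s\<ge>0. s \<le> 1 \<and> det (B s) = 0"
      using cont by (intro IVT2') (auto simp: B_def)
    with nz show False by blast
  qed
qed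

lemma chart_density:
  assumes "riemannian_manifold \<A> g" "(U, \<phi>) \<in> \<A>"
  shows "continuous_on (\<phi> ` U) (\<lambda>y. sqrt (det (g (U, \<phi>) y)))"
    and "y \<in> \<phi> ` U \<Longrightarrow> 0 < sqrt (det (g (U, \<phi>) y))"
proof -
  have "smooth_on (\<phi> ` U) (g (U, \<phi>))" and pos: "\<And>y v. y \<in> \<phi> ` U \<Longrightarrow> v \<noteq> 0 \<Longrightarrow> 0 < v \<bullet> (g (U, \<phi>) y *v v)"
    using assms unfolding riemannian_manifold_def riemannian_metric_def by auto
  then have "Ck_on 0 (g (U, \<phi>)) (\<phi> ` U)" unfolding smooth_on_def by blast
  then show "continuous_on (\<phi> ` U) (\<lambda>y. sqrt (det (g (U, \<phi>) y)))"
    by (intro continuous_intros continuous_on_det) simp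
  show "0 < sqrt (det (g (U, \<phi>) y))" if "y \<in> \<phi> ` U"
    using det_pos_of_positive_definite[OF pos[OF that]] by simp
qed

lemma chart_at:
  assumes "riemannian_manifold \<A> g"
  obtains U \<phi> where "(U, \<phi>) \<in> \<A>" "x \<in> U" "open U" "open (\<phi> ` U)" "continuous_on U \<phi>"
    "\<And>B. open B \<Longrightarrow> B \<subseteq> U \<Longrightarrow> open (\<phi> ` B)"
proof -
  have "smooth_atlas \<A>" using assms by (simp add: riemannian_manifold_def)
  then have cover: "x \<in> (\<Union>c\<in>\<A>. fst c)"
    and charts: "\<And>U \<phi>. (U, \<phi>) \<in> \<A> \<Longrightarrow> open U \<and> open (\<phi> ` U) \<and> (\<exists>\<psi>. homeomorphism U (\<phi> ` U) \<phi> \<psi>)"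
    unfolding smooth_atlas_def by auto
  from cover obtain U \<phi> where U: "(U, \<phi>) \<in> \<A>" "x \<in> U" by auto
  then obtain \<psi> where U: "(U, \<phi>) \<in> \<A>" "x \<in> U" "open U" "open (\<phi> ` U)"
      and hom: "homeomorphism U (\<phi> ` U) \<phi> \<psi>"
    using charts[OF U(1)] by blast
  have "open (\<phi> ` B)" if B: "open B" "B \<subseteq> U" for B
  proof -
    have "openin (top_of_set U) B" using B U(3) by (simp add: openin_open_eq)
    then show ?thesis using homeomorphism_imp_open_map[OF hom] U(4) openin_open_eq by blast
  qed
  with U that homeomorphism_cont1[OF hom] show ?thesis by blast
qed

text \<open>
  The density is continuous and positive, so near \<open>\<phi> x\<close> it exceeds half of its value there.
\<close>

lemma riemannian_volume_open_pos:
  assumes M: "riemannian_manifold \<A> g" and vol: "is_riemannian_volume \<A> g \<L>"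
    and V: "open V" "x \<in> V"
  shows "0 < emeasure \<L> V"
proof -
  obtain U \<phi> where U: "(U, \<phi>) \<in> \<A>" "x \<in> U" "open U" "open (\<phi> ` U)"
      and \<phi>: "\<And>B. open B \<Longrightarrow> B \<subseteq> U \<Longrightarrow> open (\<phi> ` B)"
    using chart_at[OF M] by metis
  define f where "f y = sqrt (det (g (U, \<phi>) y))" for y
  have f: "continuous_on (\<phi> ` U) f" "0 < f (\<phi> x)"
    using chart_density[OF M U(1)] U(2) by (auto simp: f_def)
  define B where "B = \<phi> ` (V \<inter> U) \<inter> {y \<in> \<phi> ` U. f (\<phi> x) / 2 < f y}"
  have "open {y \<in> \<phi> ` U. f (\<phi> x) / 2 < f y}"
    using continuous_open_preimage[OF f(1) U(4), of "{f (\<phi> x) / 2<..}"]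
    by (simp add: vimage_def Int_def)
  then have B: "open B" using \<phi>[of "V \<inter> U"] V U by (auto simp: B_def)
  have "\<phi> x \<in> B" using V U f by (auto simp: B_def)
  then have "\<not> negligible B" using B open_not_negligible by blast
  then have "emeasure lborel B \<noteq> 0"
    using B null_sets_completionI[of B lborel] by (auto simp: negligible_iff_null_sets null_sets_def)
  then have "0 < ennreal (f (\<phi> x) / 2) * emeasure lborel B"
    using f by (simp add: ennreal_zero_less_mult_iff zero_less_iff_neq_zero)
  also have "\<dots> = (\<integral>\<^sup>+y. ennreal (f (\<phi> x) / 2) * indicator B y \<partial>lborel)"
    using B by (intro nn_integral_cmult_indicator[symmetric]) simp
  also have "\<dots> \<le> (\<integral>\<^sup>+y\<in>\<phi> ` (V \<inter> U). ennreal (f y) \<partial>lborel)"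
    by (intro nn_integral_mono) (auto simp: B_def indicator_def intro!: ennreal_leI)
  also have "\<dots> = emeasure \<L> (V \<inter> U)"
    using vol U(1,3) V(1) unfolding is_riemannian_volume_def f_def by fastforce
  also have "\<dots> \<le> emeasure \<L> V"
    using V vol by (intro emeasure_mono) (auto simp: is_riemannian_volume_def)
  finally show ?thesis .
qed

lemma riemannian_volume_locally_finite:
  assumes M: "riemannian_manifold \<A> g" and vol: "is_riemannian_volume \<A> g \<L>"
  obtains V where "open V" "x \<in> V" "emeasure \<L> V < \<infinity>"
proof -
  obtain U \<phi> where U: "(U, \<phi>) \<in> \<A>" "x \<in> U" "open U" "open (\<phi> ` U)" "continuous_on U \<phi>"
    using chart_at[OF M] by metis
  define f where "f y = sqrt (det (g (U, \<phi>) y))" for y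
  have f: "continuous_on (\<phi> ` U) f" using chart_density[OF M U(1)] by (simp add: f_def)
  define B where "B = ball (\<phi> x) 1 \<inter> {y \<in> \<phi> ` U. f y < f (\<phi> x) + 1}"
  have "open {y \<in> \<phi> ` U. f y < f (\<phi> x) + 1}"
    using continuous_open_preimage[OF f U(4), of "{..<f (\<phi> x) + 1}"]
    by (simp add: vimage_def Int_def)
  then have B: "open B" by (auto simp: B_def)
  define V where "V = U \<inter> \<phi> -` B"
  have V: "open V" unfolding V_def using U B by (intro continuous_open_preimage)
  have "x \<in> V" using U by (auto simp: V_def B_def)
  have "emeasure \<L> V = (\<integral>\<^sup>+y\<in>\<phi> ` V. ennreal (f y) \<partial>lborel)"
    using vol U(1) V unfolding is_riemannian_volume_def f_def V_def by fastforce
  also have "\<dots> \<le> (\<integral>\<^sup>+y. ennreal (f (\<phi> x) + 1) * indicator (ball (\<phi> x) 1) y \<partial>lborel)"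
    by (intro nn_integral_mono) (auto simp: V_def B_def indicator_def intro!: ennreal_leI)
  also have "\<dots> = ennreal (f (\<phi> x) + 1) * emeasure lborel (ball (\<phi> x) 1)"
    by (rule nn_integral_cmult_indicator) simp
  also have "\<dots> < \<infinity>"
    using emeasure_bounded_finite[OF bounded_ball, of "\<phi> x" 1] by (simp add: ennreal_mult_less_top)
  finally show ?thesis using that V \<open>x \<in> V\<close> by blast
qed

lemma volume_finite_near_compact:
  fixes K :: "'m::metric_space set"
  assumes K: "compact K" and L: "sets L = sets borel"
    and fin: "\<And>x. \<exists>V. open V \<and> x \<in> V \<and> emeasure L V < \<infinity>"
  obtains W r where "open W" "emeasure L W < \<infinity>" "0 < r" "\<And>x. x \<in> K \<Longrightarrow> ball x r \<subseteq> W"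
proof -
  obtain V where V: "\<And>x. open (V x)" "\<And>x. x \<in> V x" "\<And>x. emeasure L (V x) < \<infinity>"
    using fin by metis
  obtain F where F: "F \<subseteq> K" "finite F" "K \<subseteq> (\<Union>x\<in>F. V x)"
    by (rule compactE_image[OF K, of K V]) (use V in auto)
  define W where "W = (\<Union>x\<in>F. V x)"
  have "emeasure L W \<le> (\<Sum>x\<in>F. emeasure L (V x))"
    unfolding W_def using V(1) F(2) L by (intro emeasure_subadditive_finite) auto
  also have "\<dots> < \<infinity>" using V(3) F(2) by (simp add: less_top[symmetric])
  finally have "emeasure L W < \<infinity>" .
  moreover have W: "open W" using V(1) by (auto simp: W_def)
  moreover obtain r where "0 < r" "(\<Union>x\<in>K. ball x r) \<subseteq> W"
    using compact_subset_open_imp_ball_epsilon_subset[OF K W] F(3) by (auto simp: W_def)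
  ultimately show ?thesis using that by blast
qed

section \<open>Dynamical balls and local volume growth\<close>

lemma mem_dyn_ball_iff:
  assumes "1 \<le> n"
  shows "y \<in> dyn_ball T n x r \<longleftrightarrow> (\<forall>i<n. dist ((T ^^ i) x) ((T ^^ i) y) < r)"
proof -
  have "(\<lambda>i. dist ((T ^^ i) x) ((T ^^ i) y)) ` {..<n} \<noteq> {}" using assms by (auto simp: lessThan_empty_iff)
  then show ?thesis unfolding dyn_ball_def dyn_dist_def by (subst mem_Collect_eq, subst Max_less_iff) auto
qed

lemma dyn_ball_subset_ball: "1 \<le> n \<Longrightarrow> dyn_ball T n x r \<subseteq> ball x r"
  by (force simp: mem_dyn_ball_iff)

lemma continuous_on_funpow:
  fixes T :: "'a::topological_space \<Rightarrow> 'a"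
  assumes "continuous_on UNIV T"
  shows "continuous_on UNIV (T ^^ n)"
  using assms
proof (induction n)
  case (Suc n)
  then show ?case
    using continuous_on_compose[of UNIV "T ^^ n" T] continuous_on_subset by (auto simp: comp_def)
qed (simp add: id_def)

text \<open>
  Openness in both variables jointly makes the volume of \<open>B\<^sub>n(x, r)\<close> a measurable function of \<open>x\<close>.
\<close>

lemma open_dyn_ball_pairs:
  fixes T :: "'m::metric_space \<Rightarrow> 'm"
  assumes T: "continuous_on UNIV T" and n: "1 \<le> n"
  shows "open {(x, y). y \<in> dyn_ball T n x r}"
proof -
  have "{(x, y). y \<in> dyn_ball T n x r} = (\<Inter>i\<in>{..<n}. {z. dist ((T ^^ i) (fst z)) ((T ^^ i) (snd z)) < r})"
    using n by (auto simp: mem_dyn_ball_iff)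
  moreover have "open {z. dist ((T ^^ i) (fst z)) ((T ^^ i) (snd z)) < r}" for i
    by (intro open_Collect_less continuous_intros
        continuous_on_compose2[OF continuous_on_funpow[OF T]]) auto
  ultimately show ?thesis by auto
qed

lemma open_dyn_ball:
  fixes T :: "'m::metric_space \<Rightarrow> 'm"
  assumes T: "continuous_on UNIV T" and n: "1 \<le> n"
  shows "open (dyn_ball T n x r)"
proof -
  have "dyn_ball T n x r = UNIV \<inter> Pair x -` {(x, y). y \<in> dyn_ball T n x r}" by auto
  also have "open \<dots>"
    by (intro continuous_open_preimage open_dyn_ball_pairs T n continuous_intros) auto
  finally show ?thesis .
qed

text \<open>
  Such a function has a one-sided limit at 0, namely the supremum of its values on the interval
  from 0 to \<open>a\<close>.
\<close>

lemma Lim_at_right_antimono: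
  fixes F :: "real \<Rightarrow> ereal"
  assumes anti: "\<And>r s. 0 < r \<Longrightarrow> r \<le> s \<Longrightarrow> s \<le> a \<Longrightarrow> F s \<le> F r" and r: "0 < r" "r \<le> a"
  shows "F r \<le> Lim (at_right 0) F"
proof -
  define S where "S = (SUP s\<in>{0<..a}. F s)"
  have "(F \<longlongrightarrow> S) (at_right 0)"
  proof (rule order_tendstoI)
    fix c assume "c < S"
    then obtain s where s: "0 < s" "s \<le> a" "c < F s" unfolding S_def less_SUP_iff by auto
    show "\<forall>\<^sub>F r in at_right 0. c < F r"
      using eventually_at_right_less[of 0] eventually_at_right_real[OF s(1)]
    proof eventually_elim
      case (elim r)
      then show ?case using s anti[of r s] by auto
    qed
  next
    fix c assume c: "S < c"
    show "\<forall>\<^sub>F r in at_right 0. F r < c"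
      using eventually_at_right_real[OF less_le_trans[OF r]]
    proof eventually_elim
      case (elim r)
      then have "F r \<le> S" unfolding S_def by (intro SUP_upper) auto
      then show ?case using c by simp
    qed
  qed
  then have "Lim (at_right 0) F = S" by (intro tendsto_Lim) simp
  moreover have "F r \<le> S" unfolding S_def using r by (intro SUP_upper) auto
  ultimately show ?thesis by simp
qed

text \<open>
  The upper limits in the definition of the local volume growth increase as the radius \<open>s\<close>
  decreases, as long as \<open>s \<le> a\<close>: up to this radius all volumes are positive and finite, so the
  logarithm is monotone. Hence each of them is bounded by the local volume growth.
\<close>

lemma eventually_volume_dyn_ball_gt:
  fixes T :: "'m::metric_space \<Rightarrow> 'm" and h :: real
  assumes T: "continuous_on UNIV T" and L: "sets L = sets borel"
    and pos: "\<And>V x. open V \<Longrightarrow> x \<in> V \<Longrightarrow> 0 < emeasure L V"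
    and W: "open W" "emeasure L W < \<infinity>" "ball x a \<subseteq> W"
    and r: "0 < r" "r \<le> a"
    and h: "local_volume_growth L T K x < ereal h"
  shows "\<forall>\<^sub>F n in sequentially. (T ^^ n) x \<in> K \<longrightarrow> exp (- (real n * h)) < measure L (dyn_ball T n x r)"
proof -
  define F where "F r = Limsup (inf sequentially (principal {n. (T ^^ n) x \<in> K}))
    (\<lambda>n. ereal (- (1 / real n) * ln (measure L (dyn_ball T n x r))))" for r
  have vol: "0 < measure L (dyn_ball T n x s) \<and> dyn_ball T n x s \<in> sets L \<and> emeasure L (dyn_ball T n x s) < \<infinity>"
    if n: "1 \<le> n" and s: "0 < s" "s \<le> a" for n s
  proof -
    have o: "open (dyn_ball T n x s)" by (rule open_dyn_ball[OF T n])
    have "dyn_ball T n x s \<subseteq> W"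
      using dyn_ball_subset_ball[OF n] s W(3) by (meson subset_ball order_trans)
    then have fin: "emeasure L (dyn_ball T n x s) < \<infinity>"
      using emeasure_mono[of "dyn_ball T n x s" W L] W L by (auto intro: le_less_trans)
    have "x \<in> dyn_ball T n x s" using n s by (simp add: mem_dyn_ball_iff)
    then have "0 < emeasure L (dyn_ball T n x s)" using pos o by blast
    then show ?thesis using fin o L by (simp add: measure_def enn2real_positive_iff)
  qed
  have "F s \<le> F q" if qs: "0 < q" "q \<le> s" "s \<le> a" for q s
    unfolding F_def
  proof (rule Limsup_mono)
    have "\<forall>\<^sub>F n in sequentially. ereal (- (1 / real n) * ln (measure L (dyn_ball T n x s)))
        \<le> ereal (- (1 / real n) * ln (measure L (dyn_ball T n x q)))"
      using eventually_ge_at_top[of 1]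
    proof eventually_elim
      case (elim n)
      have "dyn_ball T n x q \<subseteq> dyn_ball T n x s" using elim qs by (fastforce simp: mem_dyn_ball_iff)
      then have "measure L (dyn_ball T n x q) \<le> measure L (dyn_ball T n x s)"
        using vol[OF elim, of s] vol[OF elim, of q] qs by (intro measure_mono_fmeasurable) (auto simp: fmeasurable_def)
      then show ?case
        using vol[OF elim, of q] qs by (auto intro!: divide_right_mono)
    qed
    then show "\<forall>\<^sub>F n in inf sequentially (principal {n. (T ^^ n) x \<in> K}).
        ereal (- (1 / real n) * ln (measure L (dyn_ball T n x s)))
        \<le> ereal (- (1 / real n) * ln (measure L (dyn_ball T n x q)))"
      by (rule filter_leD[OF inf_le1])
  qed
  then have "F r \<le> local_volume_growth L T K x"
    unfolding local_volume_growth_def F_def[symmetric] using Lim_at_right_antimono[of a F r] r by blast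
  then have "F r < ereal h" using h by simp
  then have "\<forall>\<^sub>F n in inf sequentially (principal {n. (T ^^ n) x \<in> K}).
      ereal (- (1 / real n) * ln (measure L (dyn_ball T n x r))) < ereal h"
    unfolding F_def by (rule Limsup_lessD)
  then have "\<forall>\<^sub>F n in sequentially. (T ^^ n) x \<in> K \<longrightarrow> - (1 / real n) * ln (measure L (dyn_ball T n x r)) < h"
    by (simp add: eventually_inf_principal)
  then show ?thesis
    using eventually_ge_at_top[of 1]
  proof eventually_elim
    case (elim n)
    show ?case
    proof
      assume "(T ^^ n) x \<in> K"
      then have "- (real n * h) < ln (measure L (dyn_ball T n x r))"
        using elim by (simp add: field_simps)
      then show "exp (- (real n * h)) < measure L (dyn_ball T n x r)"
        using vol[OF elim(2) r] by (metis exp_less_cancel_iff exp_ln)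
    qed
  qed
qed

text \<open>
  The volume is replaced by its restriction to \<open>W\<close>, which is finite, so that the measures of the
  sections of an open set of pairs depend measurably on the base point.
\<close>

lemma sets_small_dyn_ball:
  fixes T :: "'m::{metric_space, second_countable_topology} \<Rightarrow> 'm"
  assumes T: "continuous_on UNIV T" and L: "sets L = sets borel"
    and W: "open W" "emeasure L W < \<infinity>" "\<And>x. x \<in> K \<Longrightarrow> ball x r \<subseteq> W"
    and K: "K \<in> sets borel" and n: "1 \<le> n"
  shows "{x \<in> K. measure L (dyn_ball T n x r) \<le> c} \<in> sets borel"
proof -
  define N where "N = density L (indicator W)"
  have sets_N: "sets N = sets borel" by (simp add: N_def L)
  have meas_N: "emeasure N B = emeasure L (W \<inter> B)" if "B \<in> sets borel" for B
    unfolding N_def using W L that by (intro emeasure_restricted) auto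
  have "space N = UNIV" using sets_eq_imp_space_eq[OF sets_N] by simp
  then interpret N: finite_measure N
    using meas_N[of UNIV] W by (intro finite_measureI) auto
  define Q where "Q = {(x, y). y \<in> dyn_ball T n x r}"
  have "Q \<in> sets (borel \<Otimes>\<^sub>M borel)"
    unfolding borel_prod Q_def using open_dyn_ball_pairs[OF T n] by (rule borel_open)
  also have "sets (borel \<Otimes>\<^sub>M borel) = sets (borel \<Otimes>\<^sub>M N)"
    using sets_N by (intro sets_pair_measure_cong) auto
  finally have "(\<lambda>x. emeasure N (Pair x -` Q)) \<in> borel_measurable borel"
    by (rule N.measurable_emeasure_Pair)
  then have "(\<lambda>x. enn2real (emeasure N (Pair x -` Q))) \<in> borel_measurable borel"
    by (rule measurable_compose) simp
  then have m: "{x \<in> space borel. enn2real (emeasure N (Pair x -` Q)) \<le> c} \<in> sets borel"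
    by (rule borel_measurable_le) simp
  have "enn2real (emeasure N (Pair x -` Q)) = measure L (dyn_ball T n x r)" if "x \<in> K" for x
  proof -
    have "Pair x -` Q = dyn_ball T n x r" by (auto simp: Q_def)
    moreover have "W \<inter> dyn_ball T n x r = dyn_ball T n x r"
      using dyn_ball_subset_ball[OF n] W(3)[OF that] by blast
    ultimately show ?thesis
      using meas_N[of "dyn_ball T n x r"] open_dyn_ball[OF T n] by (simp add: measure_def)
  qed
  then have "{x \<in> K. measure L (dyn_ball T n x r) \<le> c} =
      K \<inter> {x \<in> space borel. enn2real (emeasure N (Pair x -` Q)) \<le> c}" by auto
  then show ?thesis using m K by simp
qed

section \<open>Sets of small measure\<close>

lemma (in prob_space) measure_tendsto_0_of_eventually_not_mem:
  assumes B: "\<And>n. B n \<in> sets M" and ae: "AE x in M. \<forall>\<^sub>F n in sequentially. x \<notin> B n"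
  shows "(\<lambda>n. measure M (B n)) \<longlonglongrightarrow> 0"
proof -
  have "(\<lambda>n. \<integral>x. indicator (B n) x \<partial>M) \<longlonglongrightarrow> (\<integral>x. (0::real) \<partial>M)"
  proof (rule integral_dominated_convergence[where w = "\<lambda>_. 1"])
    show "AE x in M. (\<lambda>n. indicator (B n) x :: real) \<longlonglongrightarrow> 0"
      using ae
    proof eventually_elim
      case (elim x)
      then show ?case by (intro tendsto_eventually) (auto elim: eventually_mono)
    qed
  qed (use B in auto)
  then show ?thesis using B sets.sets_into_space by (simp add: Int_absorb2)
qed

lemma (in prob_space) measure_frequent_visits_le:
  fixes a :: real and n :: nat
  assumes T: "invariant_measure T M" and R: "R \<in> sets M" and a: "0 < a" and n: "1 \<le> n"
  shows "{x \<in> space M. a * n \<le> card {i. i < n \<and> (T ^^ i) x \<in> R}} \<in> sets M"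
    and "measure M {x \<in> space M. a * n \<le> card {i. i < n \<and> (T ^^ i) x \<in> R}} \<le> measure M R / a"
proof -
  have Tm: "T \<in> measurable M M" using T by (simp add: invariant_measure_def)
  define E where "E i = (T ^^ i) -` R \<inter> space M" for i
  define u where "u x = (\<Sum>i<n. indicator (E i) x :: real)" for x
  have E: "E i \<in> sets M" for i
    unfolding E_def using measurable_funpow[OF Tm] R by (rule measurable_sets)
  have u: "u x = card {i. i < n \<and> (T ^^ i) x \<in> R}" if "x \<in> space M" for x
    using that by (simp add: u_def E_def indicator_def sum.If_cases lessThan_def Int_def)
  have um: "integrable M u" unfolding u_def using E by (auto simp: emeasure_eq_measure)
  have eq: "{x \<in> space M. a * n \<le> card {i. i < n \<and> (T ^^ i) x \<in> R}} = {x \<in> space M. a * n \<le> u x}"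
    using u by auto
  show "{x \<in> space M. a * n \<le> card {i. i < n \<and> (T ^^ i) x \<in> R}} \<in> sets M"
    unfolding eq using um by measurable
  have "(\<integral>x. u x \<partial>M) = (\<Sum>i<n. measure M (E i))"
    unfolding u_def using E sets.sets_into_space
    by (subst Bochner_Integration.integral_sum) (auto simp: emeasure_eq_measure Int_absorb2)
  also have "\<dots> = n * measure M R"
    unfolding E_def by (simp add: measure_funpow_vimage[OF T R])
  finally have int: "(\<integral>x. u x \<partial>M) = n * measure M R" .
  have "measure M {x \<in> space M. a * n \<le> u x} \<le> (\<integral>x. u x \<partial>M) / (a * n)"
    using a n by (intro integral_Markov_inequality_measure[OF um sets.top]) (auto simp: u_def sum_nonneg)
  then show "measure M {x \<in> space M. a * n \<le> card {i. i < n \<and> (T ^^ i) x \<in> R}} \<le> measure M R / a"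
    unfolding eq int using n by simp
qed

lemma compact_inner_approximation:
  fixes M :: "'m::{complete_space, second_countable_topology} measure"
  assumes M: "finite_measure M" "sets M = sets borel" and B: "B \<in> sets borel" and e: "0 < e"
  obtains C where "C \<subseteq> B" "compact C" "measure M (B - C) < e"
proof -
  interpret finite_measure M by (rule M(1))
  have "\<exists>C\<subseteq>B. compact C \<and> measure M B - e < measure M C"
  proof (cases "measure M B = 0")
    case False
    then have "ennreal (measure M B - e) < emeasure M B"
      using e measure_nonneg[of M B] unfolding emeasure_eq_measure by (intro ennreal_lessI) linarith+
    then obtain C where C: "C \<subseteq> B" "compact C" "ennreal (measure M B - e) < emeasure M C"
      using inner_regular[OF M(2) _ B] by (auto simp: less_SUP_iff emeasure_eq_measure)
    then have "measure M B - e < measure M C"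
      unfolding emeasure_eq_measure by (metis ennreal_leI linorder_not_less)
    with C show ?thesis by blast
  qed (use e in auto)
  then obtain C where C: "C \<subseteq> B" "compact C" "measure M B - e < measure M C" by blast
  have "measure M (B - C) = measure M B - measure M C"
    using B C(1) borel_closed[OF compact_imp_closed[OF C(2)]] M(2)
    by (intro finite_measure_Diff) simp_all
  with C that show ?thesis by auto
qed

text \<open>
  The cores exist by inner regularity. They are compact, disjoint and finite in number, and
  therefore separated by a positive distance.
\<close>

lemma partition_compact_cores:
  fixes M :: "'m::{complete_space, second_countable_topology} measure"
  assumes M: "prob_space M" "sets M = sets borel" and P: "finite_measurable_partition M P" and e: "0 < e"
  obtains C s where "\<And>B. B \<in> P \<Longrightarrow> C B \<subseteq> B" "\<And>B. B \<in> P \<Longrightarrow> compact (C B)" "0 < s"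
    "\<And>A B x y. A \<in> P \<Longrightarrow> B \<in> P \<Longrightarrow> A \<noteq> B \<Longrightarrow> x \<in> C A \<Longrightarrow> y \<in> C B \<Longrightarrow> s \<le> dist x y"
    "measure M (- (\<Union>B\<in>P. C B)) < e"
proof -
  interpret prob_space M by (rule M(1))
  have space: "space M = UNIV" using sets_eq_imp_space_eq[OF M(2)] by simp
  have fin: "finite P" and PM: "\<And>B. B \<in> P \<Longrightarrow> B \<in> sets borel" and cover: "\<Union>P = UNIV"
    using P M(2) space by (auto simp: finite_measurable_partition_def partition_on_def)
  define d where "d = e / (card P + 1)"
  have d: "0 < d" using e by (simp add: d_def)
  have "\<forall>B\<in>P. \<exists>C\<subseteq>B. compact C \<and> measure M (B - C) < d"
    using compact_inner_approximation[OF finite_measure_axioms M(2) PM d] by metis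
  then obtain C where C: "\<And>B. B \<in> P \<Longrightarrow> C B \<subseteq> B" "\<And>B. B \<in> P \<Longrightarrow> compact (C B)"
      "\<And>B. B \<in> P \<Longrightarrow> measure M (B - C B) < d"
    by metis
  have "\<forall>A\<in>P. \<exists>s>0. (\<Union>x\<in>C A. ball x s) \<subseteq> - (\<Union>B\<in>P - {A}. C B)"
  proof
    fix A assume A: "A \<in> P"
    have "C A \<subseteq> - (\<Union>B\<in>P - {A}. C B)"
      using C(1) A finite_measurable_partition_disjoint[OF P] by blast
    moreover have "closed (\<Union>B\<in>P - {A}. C B)"
      using fin C(2) by (intro closed_UN) (auto intro: compact_imp_closed)
    ultimately show "\<exists>s>0. (\<Union>x\<in>C A. ball x s) \<subseteq> - (\<Union>B\<in>P - {A}. C B)"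
      using compact_subset_open_imp_ball_epsilon_subset[OF C(2)[OF A], of "- (\<Union>B\<in>P - {A}. C B)"]
      by (metis open_Compl)
  qed
  then obtain s where s: "\<And>A. A \<in> P \<Longrightarrow> 0 < s A"
      "\<And>A. A \<in> P \<Longrightarrow> (\<Union>x\<in>C A. ball x (s A)) \<subseteq> - (\<Union>B\<in>P - {A}. C B)"
    by metis
  define q where "q = Min (insert 1 (s ` P))"
  have "0 < q" using fin s(1) by (simp add: q_def)
  moreover have "q \<le> dist x y" if "A \<in> P" "B \<in> P" "A \<noteq> B" "x \<in> C A" "y \<in> C B" for A B x y
  proof -
    have "y \<notin> ball x (s A)" using s(2)[OF that(1)] that by blast
    moreover have "q \<le> s A" using fin that(1) by (simp add: q_def)
    ultimately show ?thesis by simp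
  qed
  moreover have "measure M (- (\<Union>B\<in>P. C B)) < e"
  proof -
    have sets: "B - C B \<in> sets M" if "B \<in> P" for B
      unfolding M(2) using PM[OF that] borel_closed[OF compact_imp_closed[OF C(2)[OF that]]]
      by (rule sets.Diff)
    have "- (\<Union>B\<in>P. C B) \<subseteq> (\<Union>B\<in>P. B - C B)" using cover by blast
    then have "measure M (- (\<Union>B\<in>P. C B)) \<le> measure M (\<Union>B\<in>P. B - C B)"
      using sets fin by (intro finite_measure_mono sets.finite_UN) auto
    also have "\<dots> \<le> (\<Sum>B\<in>P. measure M (B - C B))"
      using sets fin by (intro finite_measure_subadditive_finite) auto
    also have "\<dots> \<le> card P * d"
      using C(3) by (intro sum_bounded_above) (simp add: less_imp_le)
    also have "\<dots> < e" using e by (simp add: d_def field_simps)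
    finally show ?thesis .
  qed
  ultimately show ?thesis using C(1,2) by (intro that[of C q])
qed

section \<open>The entropy inequality\<close>

text \<open>
  The number of cells that meet \<open>G\<close> is bounded by \<open>card_cells_le\<close>, and the cells that do not meet
  \<open>G\<close> have total mass at most \<open>\<eta>\<close>. As \<open>\<eta> < 1\<close>, some cell does meet \<open>G\<close>.
\<close>

lemma (in prob_space) partition_entropy_iterated_join_le:
  fixes t m h :: real
  assumes T: "T \<in> measurable M M" and P: "finite_measurable_partition M P"
    and t: "0 < t" "t \<le> 1"
    and b: "\<And>x. x \<in> G \<Longrightarrow> b x \<in> sets L" "\<And>x. x \<in> G \<Longrightarrow> b x \<subseteq> W"
      "\<And>x. x \<in> G \<Longrightarrow> exp (- (real n * h)) \<le> measure L (b x)"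
    and W: "W \<in> sets L" "emeasure L W < \<infinity>"
    and close: "\<And>x y. x \<in> G \<Longrightarrow> y \<in> G \<Longrightarrow> b x \<inter> b y \<noteq> {} \<Longrightarrow> card (mismatches T P n x y) \<le> m"
    and G: "G \<in> sets M" "measure M (space M - G) \<le> \<eta>" "\<eta> < 1"
  shows "partition_entropy M (iterated_join M T P n) \<le>
    ln 2 + ln (measure L W + 1) + n * (h + ln (1 + card P * t)) - m * ln t + \<eta> * (n * ln (1 + real (card P)))"
proof -
  define J where "J = iterated_join M T P n"
  define J' where "J' = {C \<in> J. C \<inter> G \<noteq> {}}"
  have J: "finite_measurable_partition M J"
    unfolding J_def by (rule iterated_join_partition(1)[OF not_empty T P])
  then have fin: "finite J" and sets: "J \<subseteq> sets M" and cover: "\<Union>J = space M"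
    by (auto simp: finite_measurable_partition_def partition_on_def)
  have "\<Union>(J - J') \<subseteq> space M - G" using cover by (auto simp: J'_def)
  then have "measure M (\<Union>(J - J')) \<le> measure M (space M - G)"
    using G(1) by (intro finite_measure_mono) auto
  then have small: "measure M (\<Union>(J - J')) \<le> \<eta>" using G(2) by simp
  have "J' \<noteq> {}"
  proof
    assume "J' = {}"
    then have "measure M (\<Union>(J - J')) = 1" using cover prob_space by simp
    then show False using small G(3) by simp
  qed
  \<comment> \<open>The summand 1 makes the factor positive, as the logarithm will be split.\<close>
  define N where "N = (measure L W + 1) * exp (n * h) * (1 + card P * t) ^ n * t powr (- m)"
  have "card J' * exp (- (real n * h)) \<le> (1 + card P * t) ^ n * t powr (- m) * measure L W"
    unfolding J'_def J_def using card_cells_le[OF not_empty T P t b W close] by simp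
  also have "\<dots> \<le> (1 + card P * t) ^ n * t powr (- m) * (measure L W + 1)"
    using t by (intro mult_left_mono) auto
  finally have "card J' \<le> N" by (simp add: N_def exp_minus field_simps)
  moreover have "real (card J) \<le> (1 + real (card P)) ^ n"
    using sum_power_card_mismatches_le[OF not_empty T P, of 1 n] unfolding J_def by simp
  ultimately have "partition_entropy M J \<le> ln 2 + ln N + measure M (\<Union>(J - J')) * ln ((1 + real (card P)) ^ n)"
    using \<open>J' \<noteq> {}\<close> by (intro partition_entropy_le_of_concentrated[OF J]) (auto simp: J'_def)
  also have "\<dots> \<le> ln 2 + ln N + \<eta> * ln ((1 + real (card P)) ^ n)"
    using small by (intro add_left_mono mult_right_mono) (auto simp: ln_realpow)
  also have "ln N = ln (measure L W + 1) + n * (h + ln (1 + card P * t)) - m * ln t"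
  proof -
    have "0 < measure L W + 1" "0 < 1 + card P * t"
      using t measure_nonneg[of L W] by (auto intro: add_nonneg_pos add_pos_nonneg)
    then have "ln N = ln (measure L W + 1) + n * h + n * ln (1 + card P * t) + (- m) * ln t"
      using t unfolding N_def by (simp add: ln_mult ln_realpow ln_powr)
    then show ?thesis by (simp add: distrib_left)
  qed
  also have "ln ((1 + real (card P)) ^ n) = n * ln (1 + real (card P))" by (simp add: ln_realpow)
  finally show ?thesis by (simp add: J_def algebra_simps)
qed

text \<open>
  The good set \<open>G\<close> at time \<open>n\<close> consists of the points of \<open>K\<close> that return to \<open>K\<close> at time \<open>n\<close>, have
  a dynamical ball of large volume, and visit the complement \<open>R\<close> of the cores rarely. Each of
  these four conditions fails with probability at most \<open>\<delta>\<close>.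
\<close>

lemma entropy_wrt_partition_le:
  fixes T :: "'m::{complete_space, second_countable_topology} \<Rightarrow> 'm" and h :: real
  assumes T: "continuous_on UNIV T" and L: "sets L = sets borel"
    and pos: "\<And>V x. open V \<Longrightarrow> x \<in> V \<Longrightarrow> 0 < emeasure L V"
    and fin: "\<And>x. \<exists>V. open V \<and> x \<in> V \<and> emeasure L V < \<infinity>"
    and M: "prob_space M" "sets M = sets borel" and inv: "invariant_measure T M"
    and P: "finite_measurable_partition M P"
    and h: "local_riemannian_entropy L M T < ereal h"
  shows "entropy_wrt_partition M T P \<le> ereal h"
proof -
  interpret prob_space M by (rule M(1))
  have space: "space M = UNIV" using sets_eq_imp_space_eq[OF M(2)] by simp
  have Tm: "T \<in> measurable M M" using inv by (simp add: invariant_measure_def)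
  obtain l where lim: "(\<lambda>n. partition_entropy M (iterated_join M T P n) / real n) \<longlonglongrightarrow> l"
    and l: "entropy_wrt_partition M T P = ereal l"
    using entropy_wrt_partition_LIMSEQ[OF inv P] .
  have "l \<le> h + e" if e: "0 < e" for e
  proof -
    \<comment> \<open>The error terms of the estimate are \<open>4 \<delta> ln (1 + k)\<close>, \<open>ln (1 + k t)\<close> and \<open>- 2 a ln t\<close>.
      The constants make each of them at most \<open>e / 3\<close>; the choice of \<open>a\<close> depends on \<open>t\<close>.\<close>
    define k where "k = real (card P)"
    have k: "0 \<le> k" by (simp add: k_def)
    define \<delta> where "\<delta> = min (1/8) (e / (12 * (ln (1 + k) + 1)))"
    define t where "t = min 1 (e / (3 * (k + 1)))"
    define a where "a = e / (6 * (1 - ln t))"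
    have ln_k: "0 \<le> ln (1 + k)" using k by simp
    have \<delta>: "0 < \<delta>" "4 * \<delta> < 1" "4 * \<delta> * ln (1 + k) \<le> e / 3"
    proof -
      have "4 * \<delta> * ln (1 + k) \<le> 4 * (e / (12 * (ln (1 + k) + 1))) * ln (1 + k)"
        using ln_k by (intro mult_right_mono) (auto simp: \<delta>_def)
      also have "\<dots> \<le> e / 3" using e ln_k by (simp add: field_simps)
      finally show "4 * \<delta> * ln (1 + k) \<le> e / 3" .
    qed (use e ln_k in \<open>auto simp: \<delta>_def\<close>)
    have t: "0 < t" "t \<le> 1" "ln (1 + k * t) \<le> e / 3"
    proof -
      show t0: "0 < t" using e k by (simp add: t_def)
      have "ln (1 + k * t) \<le> k * t" using t0 k by (intro ln_add_one_self_le_self) simp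
      also have "\<dots> \<le> k * (e / (3 * (k + 1)))" using k by (intro mult_left_mono) (auto simp: t_def)
      also have "\<dots> \<le> e / 3" using e k by (simp add: field_simps)
      finally show "ln (1 + k * t) \<le> e / 3" .
    qed (simp add: t_def)
    have ln_t: "ln t \<le> 0" using t by simp
    have a: "0 < a" "- (2 * a * ln t) \<le> e / 3"
      using e ln_t by (auto simp: a_def field_simps)
    obtain K where K: "compact K" "measure M (UNIV - K) < \<delta>"
      using compact_inner_approximation[OF finite_measure_axioms M(2) _ \<delta>(1), of UNIV] by auto
    have KM: "K \<in> sets M" unfolding M(2) using K(1) by (intro borel_closed compact_imp_closed)
    obtain W r0 where W: "open W" "emeasure L W < \<infinity>" "0 < r0" "\<And>x. x \<in> K \<Longrightarrow> ball x r0 \<subseteq> W"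
      using volume_finite_near_compact[OF K(1) L fin] by metis
    obtain C s where C: "\<And>B. B \<in> P \<Longrightarrow> C B \<subseteq> B" "\<And>B. B \<in> P \<Longrightarrow> compact (C B)" "0 < s"
        "\<And>A B x y. A \<in> P \<Longrightarrow> B \<in> P \<Longrightarrow> A \<noteq> B \<Longrightarrow> x \<in> C A \<Longrightarrow> y \<in> C B \<Longrightarrow> s \<le> dist x y"
        "measure M (- (\<Union>B\<in>P. C B)) < \<delta> * a"
      using partition_compact_cores[OF M P, of "\<delta> * a"] \<delta>(1) a(1) by auto
    define R where "R = - (\<Union>B\<in>P. C B)"
    have RM: "R \<in> sets M"
    proof -
      have "closed (\<Union>B\<in>P. C B)"
        using P C(2) by (intro closed_UN) (auto simp: finite_measurable_partition_def compact_imp_closed)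
      then show ?thesis unfolding M(2) R_def by (intro borel_open open_Compl)
    qed
    \<comment> \<open>Two points in a common ball of radius \<open>s / 2\<close> cannot lie in different cores.\<close>
    define r where "r = min r0 (s / 2)"
    have r: "0 < r" "r \<le> r0" "2 * r \<le> s" using W(3) C(3) by (auto simp: r_def)
    have rW: "ball x r \<subseteq> W" if "x \<in> K" for x
      using W(4)[OF that] r(2) subset_ball by blast

    \<comment> \<open>The case \<open>n = 0\<close> is excluded because the dynamical distance is a maximum over the empty
      set then.\<close>
    define bad where "bad n = (if n = 0 then {} else
      {x \<in> K \<inter> (T ^^ n) -` K. measure L (dyn_ball T n x r) \<le> exp (- (real n * h))})" for n
    have KT: "(T ^^ n) -` K \<in> sets M" for n
      using measurable_sets[OF measurable_funpow[OF Tm] KM] space by simp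
    have bad_sets: "bad n \<in> sets M" for n
      using sets_small_dyn_ball[OF T L W(1,2), of "K \<inter> (T ^^ n) -` K" r n] rW KM KT[of n] M(2)
      by (auto simp: bad_def)
    have "measure M K \<noteq> 0"
    proof -
      have "measure M (UNIV - K) = 1 - measure M K" using prob_compl[OF KM] space by simp
      then show ?thesis using K(2) \<delta>(2) \<delta>(1) by linarith
    qed
    then have "0 < emeasure M K" by (simp add: emeasure_eq_measure zero_less_measure_iff)
    then have "local_riemannian_entropy_on L M T K \<le> local_riemannian_entropy L M T"
      unfolding local_riemannian_entropy_def using K(1) by (intro SUP_upper) auto
    then have "esssup (restrict_space M K) (local_volume_growth L T K) < ereal h"
      using h unfolding local_riemannian_entropy_on_def by (rule order.strict_trans1)
    \<comment> \<open>If the local volume growth were not measurable, its essential supremum would be \<open>\<infinity>\<close>.\<close>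
    then have "AE x in restrict_space M K. local_volume_growth L T K x < ereal h"
      using esssup_AE[of "local_volume_growth L T K" "restrict_space M K"]
      by (auto elim!: eventually_mono)
    then have growth: "AE x in M. x \<in> K \<longrightarrow> local_volume_growth L T K x < ereal h"
      using KM by (simp add: AE_restrict_space_iff)
    have "AE x in M. \<forall>\<^sub>F n in sequentially. x \<notin> bad n"
      using growth
    proof eventually_elim
      case (elim x)
      show ?case
      proof (cases "x \<in> K")
        case True
        have "\<forall>\<^sub>F n in sequentially. (T ^^ n) x \<in> K \<longrightarrow> exp (- (real n * h)) < measure L (dyn_ball T n x r)"
          using elim True by (intro eventually_volume_dyn_ball_gt[OF T L pos W(1,2) W(4)[OF True] r(1,2)]) auto
        then show ?thesis by eventually_elim (auto simp: bad_def)
      qed (simp add: bad_def)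
    qed
    then have "(\<lambda>n. measure M (bad n)) \<longlonglongrightarrow> 0"
      by (intro measure_tendsto_0_of_eventually_not_mem bad_sets)
    then have ev_bad: "\<forall>\<^sub>F n in sequentially. measure M (bad n) < \<delta>"
      using \<delta>(1) by (rule order_tendstoD)

    have "\<forall>\<^sub>F n in sequentially. partition_entropy M (iterated_join M T P n) / real n \<le>
        (ln 2 + ln (measure L W + 1)) / real n + (h + e)"
      using ev_bad eventually_ge_at_top[of 1]
    proof eventually_elim
      case (elim n)
      then have n: "1 \<le> n" by simp
      \<comment> \<open>As \<open>R\<close> has measure less than \<open>\<delta> a\<close>, Markov's inequality bounds the measure of this set
        by \<open>\<delta>\<close>.\<close>
      define Fq where "Fq = {x \<in> space M. a * n \<le> card {i. i < n \<and> (T ^^ i) x \<in> R}}"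
      have Fq: "Fq \<in> sets M" "measure M Fq \<le> \<delta>"
      proof -
        show "Fq \<in> sets M" unfolding Fq_def by (rule measure_frequent_visits_le[OF inv RM a(1) n])
        have "measure M Fq \<le> measure M R / a"
          unfolding Fq_def by (rule measure_frequent_visits_le[OF inv RM a(1) n])
        also have "\<dots> \<le> \<delta>" using C(5) a(1) by (simp add: R_def field_simps)
        finally show "measure M Fq \<le> \<delta>" .
      qed
      define G where "G = K \<inter> (T ^^ n) -` K - bad n - Fq"
      have G: "G \<in> sets M" unfolding G_def using KM KT bad_sets Fq by auto
      have "measure M (space M - G) \<le> 4 * \<delta>"
      proof -
        have Kc: "UNIV - K \<in> sets M" using KM space by (metis sets.compl_sets)
        have KTc: "(T ^^ n) -` (UNIV - K) \<in> sets M" "measure M ((T ^^ n) -` (UNIV - K)) = measure M (UNIV - K)"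
          using measurable_sets[OF measurable_funpow[OF Tm] Kc, of n] measure_funpow_vimage[OF inv Kc, of n] space
          by simp_all
        have "space M - G \<subseteq> ((UNIV - K) \<union> (T ^^ n) -` (UNIV - K)) \<union> (bad n \<union> Fq)"
          by (auto simp: G_def)
        then have "measure M (space M - G) \<le> measure M (((UNIV - K) \<union> (T ^^ n) -` (UNIV - K)) \<union> (bad n \<union> Fq))"
          using Kc KTc(1) bad_sets Fq(1) by (intro finite_measure_mono) auto
        also have "\<dots> \<le> (measure M (UNIV - K) + measure M ((T ^^ n) -` (UNIV - K))) + (measure M (bad n) + measure M Fq)"
          using Kc KTc(1) bad_sets Fq(1)
          by (intro order.trans[OF measure_Un_le] add_mono measure_Un_le) auto
        also have "\<dots> \<le> 4 * \<delta>" using KTc(2) K(2) elim(1) Fq(2) by simp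
        finally show ?thesis .
      qed
      have close: "card (mismatches T P n x y) \<le> 2 * a * n"
        if xy: "x \<in> G" "y \<in> G" "dyn_ball T n x r \<inter> dyn_ball T n y r \<noteq> {}" for x y
      proof -
        obtain z where "z \<in> dyn_ball T n x r" "z \<in> dyn_ball T n y r"
          using xy(3) by blast
        then have z: "dist ((T ^^ i) x) ((T ^^ i) z) < r" "dist ((T ^^ i) y) ((T ^^ i) z) < r"
          if "i < n" for i
          using that n by (auto simp: mem_dyn_ball_iff)
        have "i \<in> {i. i < n \<and> (T ^^ i) x \<in> R} \<union> {i. i < n \<and> (T ^^ i) y \<in> R}"
          if i: "i \<in> mismatches T P n x y" for i
        proof (rule ccontr)
          assume "i \<notin> {i. i < n \<and> (T ^^ i) x \<in> R} \<union> {i. i < n \<and> (T ^^ i) y \<in> R}"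
          moreover have "i < n" using i by (simp add: mismatches_def)
          ultimately obtain A B where AB: "A \<in> P" "(T ^^ i) x \<in> C A" "B \<in> P" "(T ^^ i) y \<in> C B"
            by (auto simp: R_def)
          have "dist ((T ^^ i) x) ((T ^^ i) y) < s"
            using dist_triangle3[of "(T ^^ i) x" "(T ^^ i) y" "(T ^^ i) z"] z[OF \<open>i < n\<close>] r(3)
            by (simp add: dist_commute)
          then have "A = B" using C(4)[of A B] AB by (meson not_less)
          then have "(T ^^ i) x \<in> A" "(T ^^ i) y \<in> A" using AB C(1) by blast+
          then show False using i AB(1) unfolding mismatches_def by blast
        qed
        then have "card (mismatches T P n x y) \<le>
            card ({i. i < n \<and> (T ^^ i) x \<in> R} \<union> {i. i < n \<and> (T ^^ i) y \<in> R})"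
          by (intro card_mono) auto
        also have "\<dots> \<le> card {i. i < n \<and> (T ^^ i) x \<in> R} + card {i. i < n \<and> (T ^^ i) y \<in> R}"
          by (rule card_Un_le)
        finally show ?thesis using xy(1,2) space by (simp add: G_def Fq_def)
      qed
      have "partition_entropy M (iterated_join M T P n) \<le> ln 2 + ln (measure L W + 1) +
          n * (h + ln (1 + k * t)) - (2 * a * n) * ln t + 4 * \<delta> * (n * ln (1 + k))"
        unfolding k_def
      proof (rule partition_entropy_iterated_join_le[OF Tm P t(1,2)])
        fix x assume x: "x \<in> G"
        show "dyn_ball T n x r \<in> sets L" using open_dyn_ball[OF T n] L by simp
        show "dyn_ball T n x r \<subseteq> W" using dyn_ball_subset_ball[OF n] rW x unfolding G_def by blast
        show "exp (- (real n * h)) \<le> measure L (dyn_ball T n x r)"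
          using x n by (auto simp: G_def bad_def)
      qed (use W L close G \<open>measure M (space M - G) \<le> 4 * \<delta>\<close> \<delta>(2) in auto)
      also have "\<dots> = ln 2 + ln (measure L W + 1) +
          n * (h + ln (1 + k * t) + - (2 * a * ln t) + 4 * \<delta> * ln (1 + k))"
        by (simp add: algebra_simps)
      also have "\<dots> \<le> ln 2 + ln (measure L W + 1) + n * (h + e)"
        using \<delta>(3) t(3) a(2) by (intro add_left_mono mult_left_mono) auto
      finally show ?case using n by (simp add: field_simps)
    qed
    moreover have "(\<lambda>n. (ln 2 + ln (measure L W + 1)) / real n + (h + e)) \<longlonglongrightarrow> 0 + (h + e)"
      by (intro tendsto_add lim_const_over_n tendsto_const)
    ultimately show ?thesis
      using lim by (intro tendsto_le[OF sequentially_bot]) auto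
  qed
  then have "l \<le> h" by (rule field_le_epsilon)
  then show ?thesis by (simp add: l)
qed

theorem corollary2p18:
  fixes \<A> :: "('m::{complete_space, second_countable_topology}, 'n::finite) chart set"
    and g :: "('m, 'n) chart \<Rightarrow> real ^ 'n \<Rightarrow> real ^ 'n ^ 'n"
    and \<L> \<mu> :: "'m measure"
    and T :: "'m \<Rightarrow> 'm"
  assumes "riemannian_manifold \<A> g"
    and "is_riemannian_volume \<A> g \<L>"
    and "continuous_on UNIV T"
    and "prob_space \<mu>"
    and "sets \<mu> = sets borel"
    and "invariant_measure T \<mu>"
    and "ergodic T \<mu>"
  shows "ks_entropy \<mu> T \<le> local_riemannian_entropy \<L> \<mu> T"
proof (rule ccontr)
  assume "\<not> ?thesis"
  then obtain h where h: "local_riemannian_entropy \<L> \<mu> T < ereal h" "ereal h < ks_entropy \<mu> T"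
    using ereal_dense2 not_le by metis
  have L: "sets \<L> = sets borel" using assms(2) by (simp add: is_riemannian_volume_def)
  have "ks_entropy \<mu> T \<le> ereal h"
    unfolding ks_entropy_def
  proof (intro SUP_least entropy_wrt_partition_le[OF assms(3) L _ _ assms(4-6) _ h(1)])
    show "0 < emeasure \<L> V" if "open V" "x \<in> V" for V x
      using riemannian_volume_open_pos[OF assms(1,2) that] .
    show "\<exists>V. open V \<and> x \<in> V \<and> emeasure \<L> V < \<infinity>" for x
      using riemannian_volume_locally_finite[OF assms(1,2)] by metis
  qed auto
  with h(2) show False by simp
qed

end
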